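(* Let $N\ge 1$, $T\in[0,\infty)$ and $x_0\in\mathbb{R}^N$. Let $\phi:[0,\infty)\to[0,1]$ be Lipschitz continuous. Let $\eta=(\eta^h)_{h>0}$ be a family of real random variables such that $\lim_{h\to0}\mathbb{E}[|\eta^h|]=0$ and there is a constant $C\in(0,\infty)$, independent of $h$, with $\mathbb{E}[(\eta^h)^2]<C$ for all $h>0$. For $h>0$ let $X^h$ be the trajectory on $[0,T]$ of the agent-based model with ambiguity noise (described in the context), with timestep $h$, initial opinions $x_0$ and update distance $\mu^h=Nh$. Then, as $h\to0$, $X^h$ converges in distribution in $D([0,T],\mathbb{R}^N)$ to the solution $X=(X(t):t\in[0,T])$ of $$\frac{dX_i}{dt}=\frac1N\sum_{j=1}^N \phi(|X_j-X_i|)\,(X_j-X_i),\quad i=1,\dots,N,\qquad X(0)=x_0 .$$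
   Context: Agent-based model with ambiguity noise and timestep $h>0$: the opinions $x(t)\in\mathbb{R}^N$ evolve at times $t=0,h,2h,\dots$ as a discrete-time Markov chain with $x(0)=x_0$. At each timestep a pair $(i,j)\in\{1,\dots,N\}^2$ is chosen uniformly at random with replacement (each ordered pair, including $i=j$, has probability $N^{-2}$), and an independent copy of $\eta^h$ (again denoted $\eta^h$) is drawn, independently of the past and of $(i,j)$. Put $\omega_j(t)=x_j(t)+\eta^h$. Then $$x_i(t+h)=\begin{cases}x_i(t)+\mu^h\,(\omega_j(t)-x_i(t)) & \text{with probability } \phi(|\omega_j(t)-x_i(t)|),\\ x_i(t) & \text{with probability } 1-\phi(|\omega_j(t)-x_i(t)|),\end{cases}$$ and all other coordinates are unchanged (the same $\omega_j(t)$ is used in the interaction probability and in the update). The trajectory $X^h=(X^h_t)_{t\in[0,T]}$ is the piecewise constant process $X^h_t=x(h\lfloor t/h\rfloor)$, viewed as a random element of the Skorokhod space $D([0,T],\mathbb{R}^N)$ of càdlàg functions. Convergence in distribution means $\mathbb{E}[f(X^h)]\to\mathbb{E}[f(X)]$ for every bounded continuous real-valued $f$ on $D([0,T],\mathbb{R}^N)$. *)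

theory Defs
  imports "HOL-Probability.Probability"
begin

section \<open>The Skorokhod space\<close>

text \<open>
  Elements of the space are represented by functions on the reals that are \<^const>\<open>undefined\<close> outside
  \<open>[0,T]\<close>, so that equality of functions is equality on \<open>[0,T]\<close>.
\<close>

definition cadlag :: "real \<Rightarrow> (real \<Rightarrow> 'b::metric_space) set" where
  "cadlag T = {f \<in> extensional {0..T}.
     (\<forall>t\<in>{0..<T}. (f \<longlongrightarrow> f t) (at_right t)) \<and>
     (\<forall>t\<in>{0<..T}. \<exists>l. (f \<longlongrightarrow> l) (at_left t))}"

definition time_changes :: "real \<Rightarrow> (real \<Rightarrow> real) set" where
  "time_changes T = {l. strict_mono_on {0..T} l \<and> continuous_on {0..T} l \<and> l ` {0..T} = {0..T}}"

definition skorokhod_close :: "real \<Rightarrow> real \<Rightarrow> (real \<Rightarrow> 'b::metric_space) \<Rightarrow> (real \<Rightarrow> 'b) \<Rightarrow> bool" where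
  "skorokhod_close T e f g \<longleftrightarrow>
     (\<exists>l\<in>time_changes T. \<forall>t\<in>{0..T}. \<bar>l t - t\<bar> \<le> e \<and> dist (f t) (g (l t)) \<le> e)"

text \<open>
  The value 0 off the space is a dummy that makes the function total and nonnegative, as the locale
  \<^locale>\<open>Metric_space\<close> demands; on the space the infimum is over a nonempty set.
\<close>

definition skorokhod_dist :: "real \<Rightarrow> (real \<Rightarrow> 'b::metric_space) \<Rightarrow> (real \<Rightarrow> 'b) \<Rightarrow> real" where
  "skorokhod_dist T f g =
     (if f \<in> cadlag T \<and> g \<in> cadlag T then Inf {e. 0 < e \<and> skorokhod_close T e f g} else 0)"

definition skorokhod :: "real \<Rightarrow> (real \<Rightarrow> 'b::metric_space) topology" where
  "skorokhod T = Metric_space.mtopology (cadlag T) (skorokhod_dist T)"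

lemma cadlag_bounded:
  assumes f: "f \<in> cadlag T"
  shows "bounded (f ` {0..T})"
proof -
  have loc: "\<exists>U. open U \<and> t \<in> U \<and> bounded (f ` (U \<inter> {0..T}))" if t: "t \<in> {0..T}" for t
  proof -
    have R: "\<exists>b>t. bounded (f ` ({t<..<b} \<inter> {0..T}))"
    proof (cases "t < T")
      case True
      then have "(f \<longlongrightarrow> f t) (at_right t)" using f t by (auto simp: cadlag_def)
      then have "eventually (\<lambda>s. dist (f s) (f t) < 1) (at_right t)"
        by (rule tendstoD) simp
      then obtain b where b: "b > t" "\<And>s. t < s \<Longrightarrow> s < b \<Longrightarrow> dist (f s) (f t) < 1"
        unfolding eventually_at_right_field by blast
      have "f ` ({t<..<b} \<inter> {0..T}) \<subseteq> ball (f t) 1"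
        using b(2) by (auto simp: dist_commute)
      then show ?thesis using b(1) bounded_ball bounded_subset by blast
    next
      case False
      then have "{t<..<t+1} \<inter> {0..T} = {}" using t by auto
      then show ?thesis by (intro exI[of _ "t+1"]) auto
    qed
    have L: "\<exists>a<t. bounded (f ` ({a<..<t} \<inter> {0..T}))"
    proof (cases "0 < t")
      case True
      then obtain l where "(f \<longlongrightarrow> l) (at_left t)" using f t by (force simp: cadlag_def)
      then have "eventually (\<lambda>s. dist (f s) l < 1) (at_left t)"
        by (rule tendstoD) simp
      then obtain a where a: "a < t" "\<And>s. a < s \<Longrightarrow> s < t \<Longrightarrow> dist (f s) l < 1"
        unfolding eventually_at_left_field by blast
      have "f ` ({a<..<t} \<inter> {0..T}) \<subseteq> ball l 1"
        using a(2) by (auto simp: dist_commute)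
      then show ?thesis using a(1) bounded_ball bounded_subset by blast
    next
      case False
      then have "{t-1<..<t} \<inter> {0..T} = {}" using t by auto
      then show ?thesis by (intro exI[of _ "t-1"]) auto
    qed
    from R L obtain a b where ab: "a < t" "t < b" "bounded (f ` ({t<..<b} \<inter> {0..T}))"
      "bounded (f ` ({a<..<t} \<inter> {0..T}))" by blast
    have "{a<..<b} \<inter> {0..T} \<subseteq> ({t<..<b} \<inter> {0..T}) \<union> ({a<..<t} \<inter> {0..T}) \<union> {t}"
      by auto
    then have "f ` ({a<..<b} \<inter> {0..T}) \<subseteq>
      f ` ({t<..<b} \<inter> {0..T}) \<union> f ` ({a<..<t} \<inter> {0..T}) \<union> {f t}"
      by blast
    moreover have "bounded (f ` ({t<..<b} \<inter> {0..T}) \<union> f ` ({a<..<t} \<inter> {0..T}) \<union> {f t})"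
      using ab by (intro iffD2[OF bounded_Un] conjI) auto
    ultimately have "bounded (f ` ({a<..<b} \<inter> {0..T}))" by (rule bounded_subset[rotated])
    then show ?thesis using ab by (intro exI[of _ "{a<..<b}"]) auto
  qed
  then obtain U where U: "\<And>t. t \<in> {0..T} \<Longrightarrow> open (U t) \<and> t \<in> U t \<and> bounded (f ` (U t \<inter> {0..T}))"
    by metis
  obtain C where C: "C \<subseteq> {0..T}" "finite C" "{0..T} \<subseteq> (\<Union>t\<in>C. U t)"
    by (rule compactE_image[OF compact_Icc[of 0 T], of "{0..T}" U]) (use U in blast)+
  have "bounded (\<Union>t\<in>C. f ` (U t \<inter> {0..T}))"
    using U C by (intro bounded_UN) auto
  moreover have "f ` {0..T} \<subseteq> (\<Union>t\<in>C. f ` (U t \<inter> {0..T}))" using C(3) by blast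
  ultimately show ?thesis by (rule bounded_subset)
qed

lemma time_changes_id: "(\<lambda>t. t) \<in> time_changes T"
  by (auto simp: time_changes_def strict_mono_on_def)

lemma time_changes_comp:
  assumes "k \<in> time_changes T" "l \<in> time_changes T"
  shows "(\<lambda>t. k (l t)) \<in> time_changes T"
proof -
  have k: "strict_mono_on {0..T} k" "continuous_on {0..T} k" "k ` {0..T} = {0..T}"
    and l: "strict_mono_on {0..T} l" "continuous_on {0..T} l" "l ` {0..T} = {0..T}"
    using assms by (auto simp: time_changes_def)
  have lt: "l t \<in> {0..T}" if "t \<in> {0..T}" for t using l(3) that by blast
  have "strict_mono_on {0..T} (\<lambda>t. k (l t))"
    by (intro strict_mono_onI strict_mono_onD[OF k(1)] strict_mono_onD[OF l(1)] lt)
  moreover have "continuous_on {0..T} (\<lambda>t. k (l t))"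
    using l(3) by (intro continuous_on_compose2[OF k(2) l(2)]) simp
  moreover have "(\<lambda>t. k (l t)) ` {0..T} = {0..T}"
    using k(3) l(3) by (metis image_image)
  ultimately show ?thesis by (simp add: time_changes_def)
qed

lemma time_changes_inv:
  assumes l: "l \<in> time_changes T"
  shows "the_inv_into {0..T} l \<in> time_changes T"
proof -
  have inj: "inj_on l {0..T}" and img: "l ` {0..T} = {0..T}" and c: "continuous_on {0..T} l"
    and sm: "strict_mono_on {0..T} l"
    using l by (auto simp: time_changes_def intro: strict_mono_on_imp_inj_on)
  have bij: "bij_betw l {0..T} {0..T}" using inj img by (simp add: bij_betw_def)
  have bij': "bij_betw (the_inv_into {0..T} l) {0..T} {0..T}" by (rule bij_betw_the_inv_into[OF bij])
  have "continuous_on (l ` {0..T}) (the_inv_into {0..T} l)"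
    by (rule continuous_on_inv[OF c]) (auto simp: the_inv_into_f_f[OF inj])
  moreover have "strict_mono_on {0..T} (the_inv_into {0..T} l)"
  proof (rule strict_mono_onI)
    fix r s assume rs: "r \<in> {0..T}" "s \<in> {0..T}" "r < s"
    let ?k = "the_inv_into {0..T} l"
    have k: "?k r \<in> {0..T}" "?k s \<in> {0..T}" "l (?k r) = r" "l (?k s) = s"
      using rs bij' f_the_inv_into_f_bij_betw[OF bij] by (auto simp: bij_betw_def)
    show "?k r < ?k s"
    proof (rule ccontr)
      assume "\<not> ?k r < ?k s"
      then have "l (?k s) \<le> l (?k r)"
        using k by (intro mono_onD[OF strict_mono_on_imp_mono_on[OF sm]]) auto
      with k rs show False by auto
    qed
  qed
  ultimately show ?thesis using bij' img by (auto simp: time_changes_def bij_betw_def)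
qed

lemma skorokhod_close_sym:
  assumes "skorokhod_close T e f g"
  shows "skorokhod_close T e g f"
proof -
  obtain l where l: "l \<in> time_changes T"
    "\<And>t. t \<in> {0..T} \<Longrightarrow> \<bar>l t - t\<bar> \<le> e \<and> dist (f t) (g (l t)) \<le> e"
    using assms unfolding skorokhod_close_def by auto
  let ?k = "the_inv_into {0..T} l"
  have bij: "bij_betw l {0..T} {0..T}"
    using l(1) by (auto simp: time_changes_def bij_betw_def intro: strict_mono_on_imp_inj_on)
  have "\<bar>?k t - t\<bar> \<le> e \<and> dist (g t) (f (?k t)) \<le> e" if t: "t \<in> {0..T}" for t
  proof -
    have "?k t \<in> {0..T}" "l (?k t) = t"
      using t bij_betw_the_inv_into[OF bij] f_the_inv_into_f_bij_betw[OF bij]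
      by (auto simp: bij_betw_def)
    then show ?thesis using l(2)[of "?k t"] by (simp add: dist_commute abs_minus_commute)
  qed
  then show ?thesis unfolding skorokhod_close_def using time_changes_inv[OF l(1)] by blast
qed

lemma skorokhod_close_trans:
  assumes "skorokhod_close T d f g" "skorokhod_close T e g h"
  shows "skorokhod_close T (d + e) f h"
proof -
  obtain k where k: "k \<in> time_changes T"
    "\<And>t. t \<in> {0..T} \<Longrightarrow> \<bar>k t - t\<bar> \<le> d \<and> dist (f t) (g (k t)) \<le> d"
    using assms unfolding skorokhod_close_def by auto
  obtain l where l: "l \<in> time_changes T"
    "\<And>t. t \<in> {0..T} \<Longrightarrow> \<bar>l t - t\<bar> \<le> e \<and> dist (g t) (h (l t)) \<le> e"
    using assms unfolding skorokhod_close_def by auto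
  have "\<bar>l (k t) - t\<bar> \<le> d + e \<and> dist (f t) (h (l (k t))) \<le> d + e" if t: "t \<in> {0..T}" for t
  proof -
    have kt: "k t \<in> {0..T}" using k(1) t by (auto simp: time_changes_def)
    have "dist (f t) (h (l (k t))) \<le> dist (f t) (g (k t)) + dist (g (k t)) (h (l (k t)))"
      by (rule dist_triangle)
    then show ?thesis using k(2)[OF t] l(2)[OF kt] by auto
  qed
  then show ?thesis
    unfolding skorokhod_close_def by (intro bexI[OF _ time_changes_comp[OF l(1) k(1)]] ballI)
qed

lemma skorokhod_close_ex:
  assumes "f \<in> cadlag T" "g \<in> cadlag T"
  shows "\<exists>e>0. skorokhod_close T e f g"
proof -
  have "bounded (f ` {0..T} \<union> g ` {0..T})"
    using assms by (intro iffD2[OF bounded_Un]) (auto intro: cadlag_bounded)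
  then obtain B where B: "\<forall>x\<in>f ` {0..T} \<union> g ` {0..T}. \<forall>y\<in>f ` {0..T} \<union> g ` {0..T}. dist x y \<le> B"
    unfolding bounded_two_points by blast
  have "\<forall>t\<in>{0..T}. \<bar>t - t\<bar> \<le> max B 1 \<and> dist (f t) (g t) \<le> max B 1"
    using B by (auto simp: le_max_iff_disj)
  then have "skorokhod_close T (max B 1) f g"
    unfolding skorokhod_close_def by (intro bexI[OF _ time_changes_id])
  then show ?thesis by (intro exI[of _ "max B 1"]) auto
qed

lemma skorokhod_close_eq:
  assumes f: "f \<in> cadlag T" and g: "g \<in> cadlag T"
    and close: "\<And>e. e > 0 \<Longrightarrow> \<exists>e'<e. skorokhod_close T e' f g"
  shows "f = g"
proof (rule extensionalityI[of _ "{0..T}"])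
  show "f \<in> extensional {0..T}" "g \<in> extensional {0..T}" using f g by (auto simp: cadlag_def)
  have appr: "\<exists>s\<in>{0..T}. \<bar>s - t\<bar> < e \<and> dist (f t) (g s) < e \<and> (t = T \<longrightarrow> s = T)"
    if "e > 0" and t: "t \<in> {0..T}" for e t
  proof -
    obtain e' l where e: "e' < e" and l: "l \<in> time_changes T"
      "\<And>t. t \<in> {0..T} \<Longrightarrow> \<bar>l t - t\<bar> \<le> e' \<and> dist (f t) (g (l t)) \<le> e'"
      using close[OF \<open>e > 0\<close>] unfolding skorokhod_close_def by auto
    have img: "l ` {0..T} = {0..T}" and m: "mono_on {0..T} l"
      using l(1) by (auto simp: time_changes_def intro: strict_mono_on_imp_mono_on)
    have lt: "l t \<in> {0..T}" using img t by blast
    have "l T = T" if "0 \<le> T"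
    proof -
      have "T \<in> l ` {0..T}" using img that by auto
      then obtain r where r: "r \<in> {0..T}" "l r = T" by blast
      have "l r \<le> l T" using r that by (intro mono_onD[OF m]) auto
      moreover have "l T \<in> {0..T}" using img that by auto
      ultimately show ?thesis using r by auto
    qed
    then show ?thesis using l(2)[OF t] e lt t by (intro bexI[of _ "l t"]) auto
  qed
  have T: "f T = g T" if "0 \<le> T"
  proof -
    have "dist (f T) (g T) < e" if "e > 0" for e
      using appr[OF that, of T] \<open>0 \<le> T\<close> by auto
    then show ?thesis by (metis dist_pos_lt less_irrefl)
  qed
  fix t assume t: "t \<in> {0..T}"
  show "f t = g t"
  proof (cases "t = T")
    case True
    then show ?thesis using T t by auto
  next
    case False
    then have tT: "0 \<le> t" "t < T" using t by auto
    have rf: "(f \<longlongrightarrow> f t) (at_right t)" and rg: "(g \<longlongrightarrow> g t) (at_right t)"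
      using f g tT by (auto simp: cadlag_def)
    have "dist (f t) (g t) \<le> 2 * e" if e: "e > 0" for e
    proof -
      from tendstoD[OF rf e] tendstoD[OF rg e]
      have "eventually (\<lambda>s. dist (f s) (f t) < e \<and> dist (g s) (g t) < e) (at_right t)"
        by eventually_elim simp
      then obtain b where b: "b > t" "\<And>s. t < s \<Longrightarrow> s < b \<Longrightarrow> dist (f s) (f t) < e \<and> dist (g s) (g t) < e"
        unfolding eventually_at_right_field by blast
      define c where "c = min b T"
      have c: "t < c" "c \<le> T" "c \<le> b" using b(1) tT by (auto simp: c_def)
      have main: "dist (f t) (g t) \<le> 2 * e + r" if r: "r > 0" for r
      proof -
        define u where "u = (t + c) / 2"
        define q where "q = min r ((c - t) / 2)"
        have q: "q > 0" using r c by (auto simp: q_def)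
        have u: "t < u" "u < c" "u \<in> {0..T}" using c tT by (auto simp: u_def)
        obtain s where s: "s \<in> {0..T}" "\<bar>s - u\<bar> < q" "dist (f u) (g s) < q"
          using appr[OF q u(3)] by blast
        have su: "\<bar>s - u\<bar> < (c - t) / 2" "dist (f u) (g s) < r" using s by (auto simp: q_def)
        then have "t < s" "s < c" by (auto simp: u_def field_simps abs_less_iff)
        then have gs: "dist (g s) (g t) < e" using b(2)[of s] c by auto
        have fu: "dist (f u) (f t) < e" using b(2)[of u] c u by auto
        have "dist (f t) (g t) \<le> dist (f t) (f u) + (dist (f u) (g s) + dist (g s) (g t))"
          by (meson dist_triangle add_left_mono order_trans)
        then show ?thesis using gs fu su by (simp add: dist_commute)
      qed
      then show ?thesis by (rule field_le_epsilon)
    qed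
    then have "dist (f t) (g t) \<le> 0 + e" if "e > 0" for e
      using that by (metis add_0 field_sum_of_halves half_gt_zero mult_2)
    then have "dist (f t) (g t) \<le> 0" by (rule field_le_epsilon)
    then show ?thesis by simp
  qed
qed

lemma Metric_space_skorokhod: "Metric_space (cadlag T) (skorokhod_dist T)"
proof
  have bdd: "bdd_below {e. 0 < e \<and> skorokhod_close T e f g}" for f g :: "real \<Rightarrow> 'a"
    by (intro bdd_belowI[of _ 0]) auto
  have ne: "{e. 0 < e \<and> skorokhod_close T e f g} \<noteq> {}"
    if "f \<in> cadlag T" "g \<in> cadlag T" for f g :: "real \<Rightarrow> 'a"
    using skorokhod_close_ex[OF that] by auto
  fix f g k :: "real \<Rightarrow> 'a"
  show nonneg: "0 \<le> skorokhod_dist T f g"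
    unfolding skorokhod_dist_def using ne by (auto intro!: cInf_greatest)
  have "skorokhod_close T e f g = skorokhod_close T e g f" for e
    using skorokhod_close_sym by blast
  then show "skorokhod_dist T f g = skorokhod_dist T g f"
    by (simp add: skorokhod_dist_def conj_commute)
  show "skorokhod_dist T f g = 0 \<longleftrightarrow> f = g" if fg: "f \<in> cadlag T" "g \<in> cadlag T"
  proof
    assume d: "skorokhod_dist T f g = 0"
    show "f = g"
    proof (rule skorokhod_close_eq[OF fg])
      fix e :: real assume "e > 0"
      then have "Inf {e. 0 < e \<and> skorokhod_close T e f g} < e" using d fg by (simp add: skorokhod_dist_def)
      then show "\<exists>e'<e. skorokhod_close T e' f g"
        using cInf_less_iff[OF ne[OF fg] bdd] by auto
    qed
  next
    assume "f = g"
    have "skorokhod_close T e f f" if "0 < e" for e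
      unfolding skorokhod_close_def using that by (intro bexI[OF _ time_changes_id]) auto
    then have "{e. 0 < e \<and> skorokhod_close T e f g} = {0<..}" using \<open>f = g\<close> by auto
    then show "skorokhod_dist T f g = 0" using fg by (simp add: skorokhod_dist_def)
  qed
  show "skorokhod_dist T f k \<le> skorokhod_dist T f g + skorokhod_dist T g k"
    if fgk: "f \<in> cadlag T" "g \<in> cadlag T" "k \<in> cadlag T"
  proof (rule field_le_epsilon)
    fix e :: real assume "e > 0"
    have "Inf {e. 0 < e \<and> skorokhod_close T e f g} < skorokhod_dist T f g + e / 2"
      "Inf {e. 0 < e \<and> skorokhod_close T e g k} < skorokhod_dist T g k + e / 2"
      using fgk \<open>e > 0\<close> by (auto simp: skorokhod_dist_def)
    then obtain a b where ab: "0 < a" "a < skorokhod_dist T f g + e / 2" "skorokhod_close T a f g"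
      "0 < b" "b < skorokhod_dist T g k + e / 2" "skorokhod_close T b g k"
      unfolding cInf_less_iff[OF ne[OF fgk(1,2)] bdd] cInf_less_iff[OF ne[OF fgk(2,3)] bdd] by auto
    have "skorokhod_dist T f k \<le> a + b"
      using fgk ab skorokhod_close_trans[OF ab(3,6)]
      by (auto simp: skorokhod_dist_def intro!: cInf_lower bdd)
    then show "skorokhod_dist T f k \<le> skorokhod_dist T f g + skorokhod_dist T g k + e"
      using ab by auto
  qed
qed

lemma topspace_skorokhod: "topspace (skorokhod T) = cadlag T"
  by (simp add: skorokhod_def Metric_space.topspace_mtopology[OF Metric_space_skorokhod])


section \<open>Convergence in distribution in a topological space\<close>

definition converges_in_distribution ::
    "'b topology \<Rightarrow> ('h \<Rightarrow> 'a measure) \<Rightarrow> ('h \<Rightarrow> 'a \<Rightarrow> 'b) \<Rightarrow> 'c measure \<Rightarrow> ('c \<Rightarrow> 'b) \<Rightarrow> 'h filter \<Rightarrow> bool"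
  where
  "converges_in_distribution S M Z N Y F \<longleftrightarrow>
     (\<forall>f. continuous_map S euclideanreal f \<and> bounded (f ` topspace S) \<longrightarrow>
        ((\<lambda>h. \<integral>\<omega>. f (Z h \<omega>) \<partial>M h) \<longlongrightarrow> (\<integral>\<omega>. f (Y \<omega>) \<partial>N)) F)"


section \<open>Discrete-time Markov chains\<close>

definition history :: "'a measure \<Rightarrow> (nat \<Rightarrow> 'a \<Rightarrow> 's::topological_space) \<Rightarrow> nat \<Rightarrow> 'a measure" where
  "history M x n =
     vimage_algebra (space M) (\<lambda>\<omega>. \<lambda>k\<in>{..n}. x k \<omega>) (\<Pi>\<^sub>M k\<in>{..n}. borel)"

definition markov_chain ::
    "'a measure \<Rightarrow> ('s::topological_space \<Rightarrow> 's measure) \<Rightarrow> 's \<Rightarrow> (nat \<Rightarrow> 'a \<Rightarrow> 's) \<Rightarrow> bool" where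
  "markov_chain M K s x \<longleftrightarrow>
     prob_space M \<and>
     (\<forall>n. x n \<in> borel_measurable M) \<and>
     (AE \<omega> in M. x 0 \<omega> = s) \<and>
     (\<forall>n. \<forall>B\<in>sets borel.
        AE \<omega> in M. real_cond_exp M (history M x n) (\<lambda>\<omega>. indicator B (x (Suc n) \<omega>)) \<omega>
                    = measure (K (x n \<omega>)) B)"


section \<open>The agent-based model with ambiguity noise\<close>

definition move :: "real \<Rightarrow> 'n \<Rightarrow> real \<Rightarrow> real ^ 'n \<Rightarrow> real ^ 'n" where
  "move \<mu> i w x = (\<chi> k. if k = i then x $ i + \<mu> * (w - x $ i) else x $ k)"

text \<open>
  One timestep from \<open>x\<close>, written in the Giry monad: draw \<open>(i,j)\<close> uniformly, then the noise \<open>e\<close> from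
  its law \<open>\<nu>\<close> independently, then accept or reject the interaction.
\<close>

definition abm_step ::
    "(real \<Rightarrow> real) \<Rightarrow> real \<Rightarrow> real measure \<Rightarrow> real ^ 'n \<Rightarrow> (real ^ 'n) measure" where
  "abm_step \<phi> \<mu> \<nu> x =
     measure_pmf (pmf_of_set (UNIV :: ('n \<times> 'n) set)) \<bind> (\<lambda>(i, j).
     \<nu> \<bind> (\<lambda>e.
     let w = x $ j + e in
     measure_pmf (bernoulli_pmf (\<phi> \<bar>w - x $ i\<bar>)) \<bind> (\<lambda>accept.
     return borel (if accept then move \<mu> i w x else x))))"

lemma
  fixes x :: "real ^ 'n"
  assumes \<phi>: "continuous_on {0..} \<phi>" "\<phi> \<in> {0..} \<rightarrow> {0..1}"
    and \<nu>: "prob_space \<nu>" "sets \<nu> = sets borel"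
  shows prob_space_abm_step: "prob_space (abm_step \<phi> \<mu> \<nu> x)" (is ?A)
    and sets_abm_step: "sets (abm_step \<phi> \<mu> \<nu> x) = sets borel" (is ?B)
    and emeasure_abm_step: "\<And>B. B \<in> sets borel \<Longrightarrow> emeasure (abm_step \<phi> \<mu> \<nu> x) B =
      (\<Sum>(i, j)\<in>UNIV. (\<integral>\<^sup>+e. (let w = x $ j + e; p = \<phi> \<bar>w - x $ i\<bar> in
         ennreal p * indicator B (move \<mu> i w x) + ennreal (1 - p) * indicator B x) \<partial>\<nu>))
      / (of_nat CARD('n))\<^sup>2" (is "\<And>B. B \<in> sets borel \<Longrightarrow> ?E B")
proof -
  interpret \<nu>: prob_space \<nu> by fact
  have sp: "space \<nu> = UNIV" using \<nu>(2) by (metis sets_eq_imp_space_eq space_borel)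
  have c: "continuous_on UNIV (\<lambda>e. \<phi> \<bar>a + e - b\<bar>)" for a b :: real
    by (intro continuous_on_compose2[OF \<phi>(1)] continuous_intros) auto
  have m1: "(\<lambda>e. \<phi> \<bar>a + e - b\<bar>) \<in> borel_measurable borel" for a b :: real
    using c by (rule borel_measurable_continuous_onI)
  have m[measurable]: "(\<lambda>e. \<phi> \<bar>a + e - b\<bar>) \<in> borel_measurable \<nu>" for a b :: real
    using m1 \<nu>(2) measurable_cong_sets by blast
  have p: "0 \<le> \<phi> \<bar>a\<bar>" "\<phi> \<bar>a\<bar> \<le> 1" for a using \<phi>(2) by (auto simp: Pi_iff)
  have mv: "(\<lambda>e. move \<mu> i (a + e) x) \<in> borel_measurable borel" for i a
    unfolding move_def
    by (intro borel_measurable_continuous_onI continuous_on_vec_lambda, rename_tac k, case_tac "k = i")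
      (auto intro!: continuous_intros)
  have mv'[measurable]: "(\<lambda>e. move \<mu> i (a + e) x) \<in> borel_measurable \<nu>" for i a
    using mv \<nu>(2) measurable_cong_sets by blast
  define R where "R = (\<lambda>i j e. measure_pmf (bernoulli_pmf (\<phi> \<bar>(x $ j + e) - x $ i\<bar>)) \<bind> (\<lambda>accept.
     return borel (if accept then move \<mu> i (x $ j + e) x else x)))"
  have Rm: "(\<lambda>b. return borel (if b then u else v)) \<in> measurable (measure_pmf q) (subprob_algebra borel)"
    for q and u v :: "real ^ 'n"
    by (intro measurable_compose[OF _ return_measurable]) (auto simp: measurable_def)
  have Rs: "sets (R i j e) = sets borel" for i j e
    unfolding R_def by (subst sets_bind[where N=borel]) auto
  have Re: "emeasure (R i j e) B = ennreal (\<phi> \<bar>(x $ j + e) - x $ i\<bar>) * indicator B (move \<mu> i (x $ j + e) x)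
    + ennreal (1 - \<phi> \<bar>(x $ j + e) - x $ i\<bar>) * indicator B x" if B: "B \<in> sets borel" for i j e B
    unfolding R_def
    using p[of "(x $ j + e) - x $ i"] B
    by (subst emeasure_bind[OF _ Rm]) (auto simp: emeasure_return mult.commute)
  have Rp: "prob_space (R i j e)" for i j e
    unfolding R_def
    by (intro prob_space.prob_space_bind[OF measure_pmf.prob_space_axioms _ Rm] AE_I2 prob_space_return) auto
  have RR: "R i j \<in> measurable \<nu> (subprob_algebra borel)" for i j
  proof (rule measurable_subprob_algebra)
    fix B :: "(real ^ 'n) set" assume [measurable]: "B \<in> sets borel"
    show "(\<lambda>e. emeasure (R i j e) B) \<in> borel_measurable \<nu>"
      by (subst Re) measurable
  qed (auto simp: Rs intro: prob_space_imp_subprob_space Rp)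
  define S where "S = (\<lambda>(i, j). \<nu> \<bind> R i j)"
  have Ss: "sets (S ij) = sets borel" for ij
    unfolding S_def using Rs by (cases ij) (auto intro!: sets_bind \<nu>.not_empty)
  have Sp: "prob_space (S ij)" for ij
    unfolding S_def by (cases ij) (auto intro!: \<nu>.prob_space_bind[OF _ RR] AE_I2 Rp)
  have SS: "S \<in> measurable (measure_pmf q) (subprob_algebra borel)" for q
    by (auto simp: measurable_def space_subprob_algebra Ss intro: prob_space_imp_subprob_space Sp)
  have K: "abm_step \<phi> \<mu> \<nu> x = measure_pmf (pmf_of_set UNIV) \<bind> S"
    unfolding abm_step_def S_def R_def Let_def ..
  show ?A unfolding K
    by (intro prob_space.prob_space_bind[OF measure_pmf.prob_space_axioms _ SS] AE_I2 Sp)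
  show ?B unfolding K by (intro sets_bind) (auto simp: Ss)
  show "?E B" if B: "B \<in> sets borel" for B
  proof -
    have "emeasure (abm_step \<phi> \<mu> \<nu> x) B = (\<integral>\<^sup>+ij. emeasure (S ij) B \<partial>measure_pmf (pmf_of_set UNIV))"
      unfolding K by (subst emeasure_bind[OF _ SS B]) auto
    also have "\<dots> = (\<Sum>ij\<in>UNIV. emeasure (S ij) B) / ennreal (CARD('n \<times> 'n))"
      by (subst nn_integral_pmf_of_set) (auto simp: ennreal_of_nat_eq_real_of_nat)
    also have "ennreal (CARD('n \<times> 'n)) = (of_nat CARD('n))\<^sup>2"
      by (simp add: power2_eq_square ennreal_mult'' ennreal_of_nat_eq_real_of_nat)
    also have "(\<Sum>ij\<in>UNIV. emeasure (S ij) B) =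
       (\<Sum>(i, j)\<in>UNIV. (\<integral>\<^sup>+e. (let w = x $ j + e; p = \<phi> \<bar>w - x $ i\<bar> in
         ennreal p * indicator B (move \<mu> i w x) + ennreal (1 - p) * indicator B x) \<partial>\<nu>))"
      unfolding S_def Let_def
      by (intro sum.cong refl) (auto simp: emeasure_bind[OF \<nu>.not_empty RR B] Re[OF B])
    finally show ?thesis .
  qed
qed

text \<open>\<open>x n\<close> stands for the opinions at time \<open>n h\<close>.\<close>

definition abm ::
    "(real \<Rightarrow> real) \<Rightarrow> real \<Rightarrow> real measure \<Rightarrow> real ^ 'n \<Rightarrow> 'a measure \<Rightarrow> (nat \<Rightarrow> 'a \<Rightarrow> real ^ 'n) \<Rightarrow> bool" where
  "abm \<phi> \<mu> \<nu> x\<^sub>0 M x \<longleftrightarrow> markov_chain M (abm_step \<phi> \<mu> \<nu>) x\<^sub>0 x"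

definition trajectory :: "real \<Rightarrow> real \<Rightarrow> (nat \<Rightarrow> 'a \<Rightarrow> 's) \<Rightarrow> 'a \<Rightarrow> real \<Rightarrow> 's" where
  "trajectory T h x \<omega> = (\<lambda>t\<in>{0..T}. x (nat \<lfloor>t / h\<rfloor>) \<omega>)"


lemma trajectory_cadlag:
  assumes h: "h > 0"
  shows "trajectory T h x \<omega> \<in> cadlag T"
proof -
  let ?f = "trajectory T h x \<omega>"
  have "(?f \<longlongrightarrow> ?f t) (at_right t)" if t: "t \<in> {0..<T}" for t
  proof (rule tendsto_eventually)
    have "t / h < \<lfloor>t / h\<rfloor> + 1" by linarith
    then have "t < h * (\<lfloor>t / h\<rfloor> + 1)" using h by (metis mult.commute pos_divide_less_eq)
    then have "eventually (\<lambda>s. s < min T (h * (\<lfloor>t / h\<rfloor> + 1))) (at_right t)"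
      using t by (intro eventually_at_rightI[of t "min T (h * (\<lfloor>t / h\<rfloor> + 1))"]) auto
    then show "eventually (\<lambda>s. ?f s = ?f t) (at_right t)"
      using eventually_at_right_less[of t]
    proof eventually_elim
      case (elim s)
      have "\<lfloor>s / h\<rfloor> = \<lfloor>t / h\<rfloor>"
      proof (rule floor_unique)
        have "of_int \<lfloor>t / h\<rfloor> \<le> t / h" by simp
        also have "\<dots> \<le> s / h" using elim h by (simp add: divide_right_mono)
        finally show "of_int \<lfloor>t / h\<rfloor> \<le> s / h" .
        show "s / h < of_int \<lfloor>t / h\<rfloor> + 1" using elim h by (simp add: field_simps)
      qed
      then show ?case using elim t by (simp add: trajectory_def)
    qed
  qed
  moreover have "\<exists>l. (?f \<longlongrightarrow> l) (at_left t)" if t: "t \<in> {0<..T}" for t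
  proof -
    let ?k = "\<lceil>t / h\<rceil> - 1"
    have "?k < t / h" by linarith
    then have lt: "h * ?k < t" using h by (metis mult.commute pos_less_divide_eq)
    have "(?f \<longlongrightarrow> x (nat ?k) \<omega>) (at_left t)"
    proof (rule tendsto_eventually)
      show "eventually (\<lambda>s. ?f s = x (nat ?k) \<omega>) (at_left t)"
      proof (rule eventually_at_leftI[of "max 0 (h * ?k)"])
        show "max 0 (h * ?k) < t" using lt t by auto
        fix s assume s: "s \<in> {max 0 (h * ?k)<..<t}"
        have "\<lfloor>s / h\<rfloor> = ?k"
        proof (rule floor_unique)
          show "of_int ?k \<le> s / h" using s h by (simp add: pos_le_divide_eq mult.commute)
          have "s / h < t / h" using s h by (simp add: divide_strict_right_mono)
          also have "\<dots> \<le> of_int ?k + 1" by simp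
          finally show "s / h < of_int ?k + 1" .
        qed
        then show "?f s = x (nat ?k) \<omega>" using s t by (simp add: trajectory_def)
      qed
    qed
    then show ?thesis by blast
  qed
  ultimately show ?thesis by (auto simp: cadlag_def trajectory_def)
qed

lemma trajectory_measurable:
  fixes x :: "nat \<Rightarrow> 'a \<Rightarrow> 's::{metric_space, second_countable_topology}"
  assumes h: "h > 0" and x: "\<And>n. x n \<in> borel_measurable M"
  shows "trajectory T h x \<in> M \<rightarrow>\<^sub>M sigma (cadlag T) {U. openin (skorokhod T) U}"
proof (rule measurable_measure_of)
  interpret D: Metric_space "cadlag T :: (real \<Rightarrow> 's) set" "skorokhod_dist T"
    by (rule Metric_space_skorokhod)
  show "{U. openin (skorokhod T) U} \<subseteq> Pow (cadlag T :: (real \<Rightarrow> 's) set)"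
    using openin_subset[of "skorokhod T"] by (auto simp: topspace_skorokhod)
  show "trajectory T h x \<in> space M \<rightarrow> cadlag T" by (simp add: trajectory_cadlag[OF h])
  fix U :: "(real \<Rightarrow> 's) set" assume U: "U \<in> {U. openin (skorokhod T) U}"
  define N where "N = nat \<lfloor>T / h\<rfloor>"
  define tr where "tr = (\<lambda>v. trajectory T h (\<lambda>n (_::unit). v n) () :: real \<Rightarrow> 's)"
  have tr: "tr v \<in> cadlag T" for v unfolding tr_def by (rule trajectory_cadlag[OF h])
  have "open (tr -` U)"
    unfolding open_fun_def openin_subopen[of _ "tr -` U"]
  proof
    fix v assume "v \<in> tr -` U"
    then obtain r where r: "r > 0" "D.mball (tr v) r \<subseteq> U"
      using U D.openin_mtopology by (auto simp: skorokhod_def)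
    define W where "W = Pi\<^sub>E UNIV (\<lambda>k. if k \<le> N then ball (v k) (r / 2) else UNIV)"
    have "openin (product_topology (\<lambda>i. euclidean) UNIV) W"
      unfolding W_def
      by (rule product_topology_basis) (auto intro: finite_subset[of _ "{..N}"])
    moreover have "v \<in> W" using r by (auto simp: W_def)
    moreover have "W \<subseteq> tr -` U"
    proof
      fix w assume w: "w \<in> W"
      have "dist (tr v t) (tr w t) \<le> r / 2" if t: "t \<in> {0..T}" for t
      proof -
        have "nat \<lfloor>t / h\<rfloor> \<le> N" unfolding N_def
          using t h by (intro nat_mono floor_mono divide_right_mono) auto
        then have "dist (v (nat \<lfloor>t / h\<rfloor>)) (w (nat \<lfloor>t / h\<rfloor>)) < r / 2"
          using w by (auto simp: W_def PiE_def Pi_iff dest!: spec[of _ "nat \<lfloor>t / h\<rfloor>"])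
        then show ?thesis using t by (simp add: tr_def trajectory_def)
      qed
      then have "skorokhod_close T (r / 2) (tr v) (tr w)"
        unfolding skorokhod_close_def using r(1) by (intro bexI[OF _ time_changes_id]) auto
      then have "skorokhod_dist T (tr v) (tr w) \<le> r / 2"
        using r(1) tr unfolding skorokhod_dist_def
        by (simp del: le_divide_eq_numeral1) (rule cInf_lower, auto intro: bdd_belowI[of _ 0])
      then have "tr w \<in> D.mball (tr v) r" using r(1) tr by auto
      then show "w \<in> tr -` U" using r(2) by auto
    qed
    ultimately show "\<exists>W. openin (product_topology (\<lambda>i. euclidean) UNIV) W \<and> v \<in> W \<and> W \<subseteq> tr -` U"
      by blast
  qed
  then have "tr -` U \<in> sets borel" by simp
  moreover have "(\<lambda>\<omega> n. x n \<omega>) \<in> borel_measurable M"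
    using x by (rule measurable_coordinatewise_then_product)
  ultimately have "(\<lambda>\<omega> n. x n \<omega>) -` (tr -` U) \<inter> space M \<in> sets M"
    by (rule measurable_sets[rotated])
  moreover have "(\<lambda>\<omega> n. x n \<omega>) -` (tr -` U) = trajectory T h x -` U"
    by (auto simp: tr_def trajectory_def)
  ultimately show "trajectory T h x -` U \<inter> space M \<in> sets M" by simp
qed


section \<open>The limiting differential equation\<close>

definition drift :: "(real \<Rightarrow> real) \<Rightarrow> real ^ 'n \<Rightarrow> real ^ 'n" where
  "drift \<phi> y = (\<chi> i. 1 / real CARD('n) * (\<Sum>j\<in>UNIV. \<phi> \<bar>y $ j - y $ i\<bar> * (y $ j - y $ i)))"

definition ode_solution :: "(real \<Rightarrow> real) \<Rightarrow> real \<Rightarrow> real ^ 'n \<Rightarrow> (real \<Rightarrow> real ^ 'n) \<Rightarrow> bool" where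
  "ode_solution \<phi> T x\<^sub>0 X \<longleftrightarrow>
     X \<in> extensional {0..T} \<and> X 0 = x\<^sub>0 \<and>
     (\<forall>t\<in>{0..T}. (X has_vector_derivative drift \<phi> (X t)) (at t within {0..T}))"

end

theory Submission
  imports Defs
begin

text \<open>
  The limit \<open>X\<close> never leaves the ball of radius \<open>|x\<^sub>0|\<close>, because the drift \<open>b\<close> satisfies \<open>y \<bullet> b y \<le> 0\<close>.
  Although \<open>b\<close> is only locally Lipschitz, \<open>|b x - b y| \<le> K |x - y|\<close> holds for all \<open>x\<close> as soon as \<open>y\<close> lies
  in that ball. Hence one step of the chain turns the squared deviation \<open>V = |x - X|\<^sup>2\<close> into at most
  \<open>(1 + B h) V + h \<epsilon>(h)\<close> in conditional mean, where \<open>\<epsilon>(h) \<longlonglongrightarrow> 0\<close>: the noise enters through \<open>E|\<eta>|\<close> to first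
  order and through \<open>E \<eta>\<^sup>2\<close> only with the factor \<open>h\<^sup>2\<close>. A maximal inequality for such almost
  supermartingales bounds the deviation uniformly on \<open>[0,T]\<close> in probability, and uniform closeness implies
  Skorokhod closeness by the identity time change.
\<close>

section \<open>The drift\<close>

text \<open>The noise may be unbounded and its second moment need not tend to 0, so the chain is not
  confined to a compact set on which the drift would be Lipschitz. The remedy is an asymmetric
  estimate: the difference of two interactions is split so that the Lipschitz constant of \<phi>
  multiplies only the argument that belongs to the differential equation, while 0 \<le> \<phi> \<le>
  1 takes care of the other one. The scale \<mu> = N h comes from the sampling: an ordered pair has
  probability 1/N^2, and \<mu>/N^2 times the sum of the pair interactions is h times the drift. In
  the expanded square the noise perturbs the cross term only linearly, since the interaction is
  compared with its value along \<open>X\<close>; this is why E|\<eta>| appears at first order. The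
  quadratic term carries \<mu>^2. That \<open>X\<close> exists and is unique is part of the claim
  and is proved as well.\<close>

lemma interaction_diff_le:
  fixes \<phi> :: "real \<Rightarrow> real"
  assumes "L-lipschitz_on {0..} \<phi>" "\<phi> \<in> {0..} \<rightarrow> {0..1}"
  shows "\<bar>\<phi> \<bar>s\<bar> * s - \<phi> \<bar>v\<bar> * v\<bar> \<le> (1 + L * \<bar>v\<bar>) * \<bar>s - v\<bar>"
proof -
  have "\<bar>\<phi> \<bar>s\<bar> - \<phi> \<bar>v\<bar>\<bar> \<le> L * \<bar>\<bar>s\<bar> - \<bar>v\<bar>\<bar>"
    using lipschitz_onD[OF assms(1), of "\<bar>s\<bar>" "\<bar>v\<bar>"] by (simp add: dist_real_def)
  also have "\<dots> \<le> L * \<bar>s - v\<bar>"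
    by (intro mult_left_mono lipschitz_on_nonneg[OF assms(1)]) simp
  finally have *: "\<bar>\<phi> \<bar>s\<bar> - \<phi> \<bar>v\<bar>\<bar> \<le> L * \<bar>s - v\<bar>" .
  have p: "0 \<le> \<phi> \<bar>s\<bar>" "\<phi> \<bar>s\<bar> \<le> 1" using assms(2) by (auto simp: Pi_iff)
  \<comment> \<open>The mixed term is chosen so that \<open>v\<close> alone multiplies the increment
    of \<phi>; hence the Lipschitz factor grows with \<open>v\<close> but not with
    \<open>s\<close>.\<close>
  have "\<phi> \<bar>s\<bar> * s - \<phi> \<bar>v\<bar> * v = \<phi> \<bar>s\<bar> * (s - v) + (\<phi> \<bar>s\<bar> - \<phi> \<bar>v\<bar>) * v"
    by (simp add: algebra_simps)
  also have "\<bar>\<dots>\<bar> \<le> \<phi> \<bar>s\<bar> * \<bar>s - v\<bar> + \<bar>\<phi> \<bar>s\<bar> - \<phi> \<bar>v\<bar>\<bar> * \<bar>v\<bar>"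
    using p by (intro order.trans[OF abs_triangle_ineq]) (simp add: abs_mult)
  also have "\<dots> \<le> 1 * \<bar>s - v\<bar> + (L * \<bar>s - v\<bar>) * \<bar>v\<bar>"
    using p * by (intro add_mono mult_right_mono) auto
  finally show ?thesis by (simp add: algebra_simps)
qed

lemma abs_diff_component_le: "\<bar>y $ j - y $ i\<bar> \<le> 2 * norm (y :: real ^ 'n)"
  using component_le_norm_cart[of y j] component_le_norm_cart[of y i] by linarith

text \<open>The constant \<open>A\<close> is abstract because two kernels are treated: \<phi>
  against a bounded \<open>y\<close>, and a cut-off kernel for arbitrary \<open>x\<close> and
  \<open>y\<close>. The 2 comes from differences of two components. The average over
  \<open>j\<close> costs nothing; the factor \<open>CARD('n)\<close> comes from bounding the
  Euclidean norm by the l1 norm.\<close>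

lemma norm_drift_diff_le:
  fixes x y :: "real ^ 'n"
  assumes A: "\<And>i j. \<bar>\<phi> \<bar>x $ j - x $ i\<bar> * (x $ j - x $ i) - \<phi> \<bar>y $ j - y $ i\<bar> * (y $ j - y $ i)\<bar>
      \<le> A * \<bar>(x $ j - x $ i) - (y $ j - y $ i)\<bar>"
    and "0 \<le> A"
  shows "norm (drift \<phi> x - drift \<phi> y) \<le> 2 * A * real CARD('n) * norm (x - y)"
proof -
  have "\<bar>(drift \<phi> x - drift \<phi> y) $ i\<bar> \<le> 2 * A * norm (x - y)" for i
  proof -
    have "(drift \<phi> x - drift \<phi> y) $ i = 1 / real CARD('n) *
        (\<Sum>j\<in>UNIV. \<phi> \<bar>x $ j - x $ i\<bar> * (x $ j - x $ i) - \<phi> \<bar>y $ j - y $ i\<bar> * (y $ j - y $ i))"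
      by (simp add: drift_def sum_subtractf diff_divide_distrib)
    also have "\<bar>\<dots>\<bar> \<le> 1 / real CARD('n) * (\<Sum>j\<in>(UNIV::'n set). 2 * A * norm (x - y))"
      unfolding abs_mult
    proof (intro mult_mono order.trans[OF sum_abs] sum_mono)
      fix j
      have "\<bar>(x $ j - x $ i) - (y $ j - y $ i)\<bar> \<le> 2 * norm (x - y)"
        using abs_diff_component_le[of "x - y" j i] by (simp add: algebra_simps)
      then have "A * \<bar>(x $ j - x $ i) - (y $ j - y $ i)\<bar> \<le> A * (2 * norm (x - y))"
        using \<open>0 \<le> A\<close> by (rule mult_left_mono)
      then show "\<bar>\<phi> \<bar>x $ j - x $ i\<bar> * (x $ j - x $ i) - \<phi> \<bar>y $ j - y $ i\<bar> * (y $ j - y $ i)\<bar>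
        \<le> 2 * A * norm (x - y)" using A[of j i] by simp
    qed (auto intro: sum_nonneg)
    finally show ?thesis by simp
  qed
  then have "(\<Sum>i\<in>UNIV. \<bar>(drift \<phi> x - drift \<phi> y) $ i\<bar>) \<le> (\<Sum>i\<in>(UNIV::'n set). 2 * A * norm (x - y))"
    by (rule sum_mono)
  with norm_le_l1_cart[of "drift \<phi> x - drift \<phi> y"] show ?thesis by (simp add: algebra_simps)
qed

lemma norm_drift_diff_le_of_lipschitz:
  fixes x y :: "real ^ 'n"
  assumes "L-lipschitz_on {0..} \<phi>" "\<phi> \<in> {0..} \<rightarrow> {0..1}" and y: "norm y \<le> r"
  shows "norm (drift \<phi> x - drift \<phi> y) \<le> 2 * (1 + 2 * L * r) * real CARD('n) * norm (x - y)"
proof (rule norm_drift_diff_le)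
  have L: "0 \<le> L" by (rule lipschitz_on_nonneg[OF assms(1)])
  have "0 \<le> r" using y norm_ge_zero[of y] by linarith
  with L show "0 \<le> 1 + 2 * L * r" by simp
  fix i j
  have "L * \<bar>y $ j - y $ i\<bar> \<le> L * (2 * r)"
    using L y abs_diff_component_le[of y j i] by (intro mult_left_mono) auto
  then have "(1 + L * \<bar>y $ j - y $ i\<bar>) * \<bar>(x $ j - x $ i) - (y $ j - y $ i)\<bar>
    \<le> (1 + 2 * L * r) * \<bar>(x $ j - x $ i) - (y $ j - y $ i)\<bar>"
    by (intro mult_right_mono) auto
  with interaction_diff_le[OF assms(1,2), of "x $ j - x $ i" "y $ j - y $ i"]
  show "\<bar>\<phi> \<bar>x $ j - x $ i\<bar> * (x $ j - x $ i) - \<phi> \<bar>y $ j - y $ i\<bar> * (y $ j - y $ i)\<bar>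
      \<le> (1 + 2 * L * r) * \<bar>(x $ j - x $ i) - (y $ j - y $ i)\<bar>" by linarith
qed

lemma drift_0 [simp]: "drift \<phi> 0 = 0"
  by (simp add: drift_def vec_eq_iff)

text \<open>The interaction coefficients are symmetric in \<open>i\<close> and \<open>j\<close>, so symmetrizing the double sum
  turns it into minus a sum of squares.\<close>

lemma inner_drift_nonpos:
  fixes y :: "real ^ 'n"
  assumes "\<phi> \<in> {0..} \<rightarrow> {0..}"
  shows "y \<bullet> drift \<phi> y \<le> 0"
proof -
  define S where "S = (\<Sum>i\<in>UNIV. \<Sum>j\<in>UNIV. \<phi> \<bar>y $ j - y $ i\<bar> * (y $ i * (y $ j - y $ i)))"
  have *: "y \<bullet> drift \<phi> y = 1 / real CARD('n) * S"
    unfolding inner_vec_def drift_def S_def by (simp add: sum_distrib_left sum_divide_distrib ac_simps)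
  have "S = (\<Sum>i\<in>UNIV. \<Sum>j\<in>UNIV. \<phi> \<bar>y $ i - y $ j\<bar> * (y $ j * (y $ i - y $ j)))"
    unfolding S_def by (rule sum.swap)
  then have "2 * S = (\<Sum>i\<in>UNIV. \<Sum>j\<in>UNIV. \<phi> \<bar>y $ j - y $ i\<bar> * (y $ i * (y $ j - y $ i)) +
      \<phi> \<bar>y $ i - y $ j\<bar> * (y $ j * (y $ i - y $ j)))"
    by (simp add: S_def sum.distrib)
  also have "\<dots> = - (\<Sum>i\<in>UNIV. \<Sum>j\<in>UNIV. \<phi> \<bar>y $ j - y $ i\<bar> * (y $ j - y $ i)\<^sup>2)"
    unfolding sum_negf[symmetric]
    by (intro sum.cong refl) (simp add: abs_minus_commute power2_eq_square algebra_simps)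
  also have "\<dots> \<le> 0"
    using assms by (auto simp: Pi_iff intro!: sum_nonneg)
  finally show ?thesis unfolding * by (simp add: divide_nonpos_pos)
qed

section \<open>The differential equation\<close>

text \<open>At the ends of the interval the derivative is one-sided, so the mean value argument runs
  in the interior, with continuity up to the boundary.\<close>

lemma decreasing_of_deriv_within_nonpos:
  fixes f :: "real \<Rightarrow> real"
  assumes f: "\<And>t. t \<in> {a..b} \<Longrightarrow> (f has_real_derivative f' t) (at t within {a..b})"
    and "\<And>t. t \<in> {a..b} \<Longrightarrow> f' t \<le> 0" and t: "t \<in> {a..b}"
  shows "f t \<le> f a"
proof (rule DERIV_nonpos_imp_decreasing_open[of a t f])
  show "a \<le> t" using t by simp
  have "continuous_on {a..b} f" using f by (rule DERIV_continuous_on)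
  then show "continuous_on {a..t} f" by (rule continuous_on_subset) (use t in auto)
  fix s assume "a < s" "s < t"
  then have "(f has_real_derivative f' s) (at s)" "f' s \<le> 0"
    using f[of s] assms(2)[of s] t by (auto simp: at_within_Icc_at)
  then show "\<exists>y. (f has_real_derivative y) (at s) \<and> y \<le> 0" by blast
qed

lemma has_real_derivative_norm_square:
  fixes X :: "real \<Rightarrow> 'b::real_inner"
  assumes "(X has_vector_derivative X') (at t within S)"
  shows "((\<lambda>t. X t \<bullet> X t) has_real_derivative 2 * (X t \<bullet> X')) (at t within S)"
  using bounded_bilinear.has_vector_derivative[OF bounded_bilinear_inner assms assms]
  by (simp add: has_real_derivative_iff_has_vector_derivative inner_commute)

text \<open>Banach's fixed point theorem in the Bielecki form: with the sup norm weighted by exp(-l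
  t) the integral operator is a contraction on all of [0,T] at once, so no short-time solutions have
  to be glued.\<close>

lemma picard_existence:
  fixes b :: "'b::banach \<Rightarrow> 'b"
  assumes b: "K-lipschitz_on UNIV b" and T: "0 \<le> T"
  shows "\<exists>X. X 0 = x0 \<and> (\<forall>t\<in>{0..T}. (X has_vector_derivative b (X t)) (at t within {0..T}))"
proof -
  \<comment> \<open>Any positive \<open>l \<ge> 2 * K\<close> gives the contraction factor 1/2; the
    added 1 keeps \<open>l\<close> positive when \<open>K = 0\<close>.\<close>
  define l where "l = 2 * K + 1"
  have K: "0 \<le> K" using b by (rule lipschitz_on_nonneg)
  then have l: "0 < l" "K / l \<le> 1 / 2" by (auto simp: l_def field_simps)
  have bc: "continuous_on S (\<lambda>u. b (f u))" if "continuous_on S f" for S and f :: "real \<Rightarrow> 'b"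
    using continuous_on_compose2[OF lipschitz_on_continuous_on[OF b] that] by simp
  \<comment> \<open>The unknown \<open>g\<close> stands for exp(-l t) X(t), so the weight is undone
    before \<open>b\<close> is applied.\<close>
  define G where "G g u = b (exp (l * u) *\<^sub>R apply_bcontfun g u)" for g :: "real \<Rightarrow>\<^sub>C 'b" and u :: real
  have Gc: "continuous_on S (G g)" for S g
    unfolding G_def by (intro bc continuous_intros) auto
  define F where "F g t = exp (- l * t) *\<^sub>R (x0 + integral {0..t} (G g))" for g t
  \<comment> \<open>\<open>clamp 0 T\<close> extends the image from [0,T] to a bounded continuous
    function on the line, so that the iteration runs in a complete space given by a type.\<close>
  have "\<exists>k. \<forall>t. apply_bcontfun k t = F g (clamp 0 T t)" for g
  proof -
    have "continuous_on (cbox 0 T) (F g)"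
      unfolding F_def box_real by (intro continuous_intros indefinite_integral_continuous_1 integrable_continuous_real Gc)
    then show ?thesis using continuous_on_cbox_bcontfunE by metis
  qed
  then obtain \<Phi> where \<Phi>: "\<And>g t. apply_bcontfun (\<Phi> g) t = F g (clamp 0 T t)" by metis
  have "\<exists>!g. \<Phi> g = g"
  proof (rule banach_fix_type[of "1/2"]; (intro allI)?)
    fix g k
    show "dist (\<Phi> g) (\<Phi> k) \<le> 1 / 2 * dist g k"
    proof (rule dist_bound)
      fix t
      define s where "s = clamp 0 T t"
      have s: "0 \<le> s" using T clamp_in_interval[of 0 T t] by (simp add: s_def)
      have int: "G g integrable_on {0..s}" "G k integrable_on {0..s}"
        by (intro integrable_continuous_real Gc)+
      \<comment> \<open>The integrated weight is K/l (exp(l s) - 1) times the distance; after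
        multiplication by exp(-l s) the factor stays below K/l \<le> 1/2.\<close>
      have I: "((\<lambda>u. K * exp (l * u) * dist g k) has_integral
          K * dist g k / l * exp (l * s) - K * dist g k / l * exp (l * 0)) {0..s}"
        using s l(1) by (intro fundamental_theorem_of_calculus)
          (auto intro!: derivative_eq_intros simp flip: has_real_derivative_iff_has_vector_derivative)
      have "dist (apply_bcontfun (\<Phi> g) t) (apply_bcontfun (\<Phi> k) t)
          = exp (- l * s) * norm (integral {0..s} (\<lambda>u. G g u - G k u))"
        unfolding \<Phi> F_def s_def[symmetric] dist_norm
        by (simp add: integral_diff[OF int] flip: scaleR_diff_right)
      also have "\<dots> \<le> exp (- l * s) * (K * dist g k / l * exp (l * s) - K * dist g k / l * exp (l * 0))"
      proof (intro mult_left_mono)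
        show "norm (integral {0..s} (\<lambda>u. G g u - G k u)) \<le> K * dist g k / l * exp (l * s) - K * dist g k / l * exp (l * 0)"
          unfolding integral_unique[OF I, symmetric]
        proof (rule integral_norm_bound_integral)
          fix u
          have "norm (G g u - G k u) \<le> K * dist (exp (l * u) *\<^sub>R apply_bcontfun g u) (exp (l * u) *\<^sub>R apply_bcontfun k u)"
            unfolding G_def using lipschitz_onD[OF b] by (simp add: dist_norm)
          also have "\<dots> = K * exp (l * u) * dist (apply_bcontfun g u) (apply_bcontfun k u)"
            by (simp add: dist_norm flip: scaleR_diff_right)
          also have "\<dots> \<le> K * exp (l * u) * dist g k"
            using K by (intro mult_left_mono dist_bounded) auto
          finally show "norm (G g u - G k u) \<le> K * exp (l * u) * dist g k" .
        qed (use I int in \<open>auto intro: integrable_diff\<close>)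
      qed simp
      also have "\<dots> = K / l * dist g k * (1 - exp (- l * s))"
        using l by (simp add: field_simps exp_minus)
      also have "\<dots> \<le> 1 / 2 * dist g k * 1"
        using l K s by (intro mult_mono) (auto simp: field_simps)
      finally show "dist (apply_bcontfun (\<Phi> g) t) (apply_bcontfun (\<Phi> k) t) \<le> 1 / 2 * dist g k" by simp
    qed
  qed auto
  then obtain g where g: "\<Phi> g = g" by blast
  define X where "X t = x0 + integral {0..t} (G g)" for t
  \<comment> \<open>On [0,T] the clamp is the identity, so the fixed point equation times exp(l t)
    is the integral equation for \<open>X\<close>.\<close>
  have X: "exp (l * t) *\<^sub>R apply_bcontfun g t = X t" if "t \<in> {0..T}" for t
    using \<Phi>[of g t] that unfolding g F_def X_def by (simp add: exp_minus)
  have "(X has_vector_derivative b (X t)) (at t within {0..T})" if t: "t \<in> {0..T}" for t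
  proof -
    have "(X has_vector_derivative 0 + G g t) (at t within {0..T})"
      unfolding X_def by (intro has_vector_derivative_add has_vector_derivative_const
        integral_has_vector_derivative Gc t)
    then show ?thesis by (simp add: G_def X[OF t])
  qed
  then show ?thesis by (intro exI[of _ X]) (simp add: X_def)
qed

text \<open>Asking only for the sign of \<phi>, without continuity or an upper bound, makes the
  estimate available for a cut-off kernel as well.\<close>

lemma norm_ode_solution_le:
  fixes X :: "real \<Rightarrow> real ^ 'n"
  assumes "\<phi> \<in> {0..} \<rightarrow> {0..}"
    and X: "\<And>t. t \<in> {0..T} \<Longrightarrow> (X has_vector_derivative drift \<phi> (X t)) (at t within {0..T})"
    and t: "t \<in> {0..T}"
  shows "norm (X t) \<le> norm (X 0)"
proof -
  have "X t \<bullet> X t \<le> X 0 \<bullet> X 0"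
    using inner_drift_nonpos[OF assms(1)]
    by (intro decreasing_of_deriv_within_nonpos[OF has_real_derivative_norm_square[OF X] _ t]) auto
  then show ?thesis by (simp add: norm_le)
qed

text \<open>Gronwall in differential form: exp(-2 K t) |X - Y|^2 does not increase. The constant
  \<open>K\<close> is valid as soon as one of the two solutions, here \<open>Y\<close>, stays in the
  ball.\<close>

lemma ode_solution_unique:
  fixes X Y :: "real \<Rightarrow> real ^ 'n"
  assumes \<phi>: "L-lipschitz_on {0..} \<phi>" "\<phi> \<in> {0..} \<rightarrow> {0..1}"
    and X: "ode_solution \<phi> T x0 X" and Y: "ode_solution \<phi> T x0 Y"
  shows "X = Y"
proof (rule extensionalityI[of _ "{0..T}"])
  show "X \<in> extensional {0..T}" "Y \<in> extensional {0..T}" using X Y by (auto simp: ode_solution_def)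
  have \<phi>0: "\<phi> \<in> {0..} \<rightarrow> {0..}" using \<phi>(2) by auto
  have X': "(X has_vector_derivative drift \<phi> (X t)) (at t within {0..T})"
    and Y': "(Y has_vector_derivative drift \<phi> (Y t)) (at t within {0..T})" if "t \<in> {0..T}" for t
    using X Y that by (auto simp: ode_solution_def)
  define K where "K = 2 * (1 + 2 * L * norm x0) * real CARD('n)"
  have K: "norm (drift \<phi> (X t) - drift \<phi> (Y t)) \<le> K * norm (X t - Y t)" if "t \<in> {0..T}" for t
    using norm_drift_diff_le_of_lipschitz[OF \<phi>, of "Y t" "norm x0" "X t"]
      norm_ode_solution_le[OF \<phi>0 Y' that] Y by (simp add: K_def ode_solution_def)
  define D where "D t = X t - Y t" for t
  have D: "((\<lambda>t. D t \<bullet> D t) has_real_derivative 2 * (D t \<bullet> (drift \<phi> (X t) - drift \<phi> (Y t)))) (at t within {0..T})"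
    if "t \<in> {0..T}" for t unfolding D_def
    by (rule has_real_derivative_norm_square[OF has_vector_derivative_diff[OF X'[OF that] Y'[OF that]]])
  fix t assume t: "t \<in> {0..T}"
  have "exp (- 2 * K * t) * (D t \<bullet> D t) \<le> exp (- 2 * K * 0) * (D 0 \<bullet> D 0)"
  proof (rule decreasing_of_deriv_within_nonpos[OF _ _ t])
    fix t assume t: "t \<in> {0..T}"
    show "((\<lambda>t. exp (- 2 * K * t) * (D t \<bullet> D t)) has_real_derivative
       exp (- 2 * K * t) * 2 * (D t \<bullet> (drift \<phi> (X t) - drift \<phi> (Y t)) - K * (D t \<bullet> D t))) (at t within {0..T})"
      by (auto intro!: derivative_eq_intros D[OF t] simp: algebra_simps)
    have "D t \<bullet> (drift \<phi> (X t) - drift \<phi> (Y t)) \<le> norm (D t) * norm (drift \<phi> (X t) - drift \<phi> (Y t))"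
      by (rule norm_cauchy_schwarz)
    also have "\<dots> \<le> norm (D t) * (K * norm (D t))"
      unfolding D_def by (intro mult_left_mono K[OF t]) auto
    also have "\<dots> = K * (D t \<bullet> D t)"
      by (simp add: dot_square_norm power2_eq_square)
    finally show "exp (- 2 * K * t) * 2 * (D t \<bullet> (drift \<phi> (X t) - drift \<phi> (Y t)) - K * (D t \<bullet> D t)) \<le> 0"
      by (intro mult_nonneg_nonpos) auto
  qed
  also have "\<dots> = 0" using X Y by (simp add: D_def ode_solution_def)
  finally have "D t \<bullet> D t \<le> 0" by (simp add: mult_le_0_iff not_le[symmetric])
  then have "D t = 0" using inner_ge_zero[of "D t"] inner_eq_zero_iff[of "D t"] by linarith
  then show "X t = Y t" by (simp add: D_def)
qed

text \<open>The drift is only locally Lipschitz. Cutting off \<open>\<phi>\<close> keeps its form, so that the a priori bound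
  still applies and shows that the solution never meets the cut-off.\<close>

lemma ode_solution_exists:
  fixes x0 :: "real ^ 'n"
  assumes \<phi>: "L-lipschitz_on {0..} \<phi>" "\<phi> \<in> {0..} \<rightarrow> {0..1}" and T: "0 \<le> T"
  shows "\<exists>X. ode_solution \<phi> T x0 X"
proof -
  \<comment> \<open>Component differences of a vector in the ball of radius \<open>norm x0\<close>
    are at most \<open>2 * norm x0\<close>; the 1 makes \<open>R\<close> positive.\<close>
  define R where "R = 2 * norm x0 + 1"
  have R: "0 < R" by (simp add: R_def add_nonneg_pos)
  \<comment> \<open>The factor truncates the interaction: \<open>\<psi> \<bar>s\<bar> * s\<close> is
    \<open>\<phi> \<bar>s\<bar>\<close> times the projection of \<open>s\<close> to [-R,R]. At
    \<open>d = 0\<close> the quotient is 0 by convention, which is harmless because the interaction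
    vanishes there. \<psi> itself may jump at 0; only its product with \<open>s\<close> is
    Lipschitz.\<close>
  define \<psi> where "\<psi> d = \<phi> d * min 1 (R / d)" for d
  define c where "c s = max (- R) (min R s)" for s :: real
  have p: "0 \<le> \<phi> \<bar>s\<bar>" "\<phi> \<bar>s\<bar> \<le> 1" for s using \<phi>(2) by (auto simp: Pi_iff)
  have L: "0 \<le> L" by (rule lipschitz_on_nonneg[OF \<phi>(1)])
  have \<psi>0: "\<psi> \<in> {0..} \<rightarrow> {0..}" using \<phi>(2) R by (auto simp: \<psi>_def Pi_iff)
  have \<psi>c: "\<psi> \<bar>s\<bar> * s = \<phi> \<bar>s\<bar> * c s" for s
    using R by (auto simp: \<psi>_def c_def min_def max_def abs_if field_simps split: if_splits)
  have \<psi>L: "\<bar>\<psi> \<bar>s\<bar> * s - \<psi> \<bar>v\<bar> * v\<bar> \<le> (1 + L * R) * \<bar>s - v\<bar>" for s v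
  proof -
    have "\<bar>\<phi> \<bar>s\<bar> - \<phi> \<bar>v\<bar>\<bar> \<le> L * \<bar>\<bar>s\<bar> - \<bar>v\<bar>\<bar>"
      using lipschitz_onD[OF \<phi>(1), of "\<bar>s\<bar>" "\<bar>v\<bar>"] by (simp add: dist_real_def)
    also have "\<dots> \<le> L * \<bar>s - v\<bar>" by (intro mult_left_mono L) simp
    finally have 1: "\<bar>\<phi> \<bar>s\<bar> - \<phi> \<bar>v\<bar>\<bar> \<le> L * \<bar>s - v\<bar>" .
    have 2: "\<bar>c s - c v\<bar> \<le> \<bar>s - v\<bar>" "\<bar>c v\<bar> \<le> R" using R by (auto simp: c_def)
    have "\<psi> \<bar>s\<bar> * s - \<psi> \<bar>v\<bar> * v = \<phi> \<bar>s\<bar> * (c s - c v) + (\<phi> \<bar>s\<bar> - \<phi> \<bar>v\<bar>) * c v"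
      unfolding \<psi>c by (simp add: algebra_simps)
    also have "\<bar>\<dots>\<bar> \<le> \<phi> \<bar>s\<bar> * \<bar>c s - c v\<bar> + \<bar>\<phi> \<bar>s\<bar> - \<phi> \<bar>v\<bar>\<bar> * \<bar>c v\<bar>"
      using p by (intro order.trans[OF abs_triangle_ineq]) (simp add: abs_mult)
    also have "\<dots> \<le> 1 * \<bar>s - v\<bar> + (L * \<bar>s - v\<bar>) * R"
      using p 1 2 R L by (intro add_mono mult_mono) auto
    finally show ?thesis by (simp add: algebra_simps)
  qed
  have "(2 * (1 + L * R) * real CARD('n))-lipschitz_on UNIV (drift \<psi> :: real ^ 'n \<Rightarrow> _)"
    unfolding lipschitz_on_def dist_norm using L R by (intro conjI ballI norm_drift_diff_le \<psi>L) auto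
  from picard_existence[OF this T, of x0] obtain X where X: "X 0 = x0"
    "\<And>t. t \<in> {0..T} \<Longrightarrow> (X has_vector_derivative drift \<psi> (X t)) (at t within {0..T})" by blast
  have "drift \<psi> (X t) = drift \<phi> (X t)" if t: "t \<in> {0..T}" for t
  proof -
    have n: "norm (X t) \<le> norm x0" using norm_ode_solution_le[OF \<psi>0 X(2) t] X(1) by simp
    have "\<psi> \<bar>X t $ j - X t $ i\<bar> * (X t $ j - X t $ i) = \<phi> \<bar>X t $ j - X t $ i\<bar> * (X t $ j - X t $ i)" for i j
    proof -
      have "\<bar>X t $ j - X t $ i\<bar> \<le> R" using abs_diff_component_le[of "X t" j i] n by (simp add: R_def)
      then have "c (X t $ j - X t $ i) = X t $ j - X t $ i" unfolding c_def by auto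
      then show ?thesis unfolding \<psi>c by simp
    qed
    then show ?thesis unfolding drift_def by (simp only:)
  qed
  with X have "((\<lambda>t. X t) has_vector_derivative drift \<phi> (X t)) (at t within {0..T})" if "t \<in> {0..T}" for t
    using that by metis
  then have "ode_solution \<phi> T x0 (restrict X {0..T})"
    unfolding ode_solution_def using X(1) T
    by (auto intro: has_vector_derivative_transform)
  then show ?thesis by blast
qed

section \<open>One timestep of the agent-based model\<close>

lemma move_eq_add_axis: "move \<mu> i w x = x + axis i (\<mu> * (w - x $ i))"
  by (auto simp: vec_eq_iff move_def axis_def)

lemma norm_move_diff_square:
  "(norm (move \<mu> i w x - z))\<^sup>2 =
    (norm (x - z))\<^sup>2 + 2 * \<mu> * (w - x $ i) * (x - z) $ i + \<mu>\<^sup>2 * (w - x $ i)\<^sup>2"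
proof -
  have "move \<mu> i w x - z = (x - z) + axis i (\<mu> * (w - x $ i))"
    by (simp add: move_eq_add_axis)
  then show ?thesis
    unfolding power2_norm_eq_inner
    by (simp add: inner_add_left inner_add_right inner_axis inner_axis' power2_eq_square algebra_simps)
qed

lemma measurable_component_cart [measurable]:
  "(\<lambda>x :: real ^ 'n. x $ i) \<in> borel_measurable borel"
  by (intro borel_measurable_continuous_onI continuous_intros)

lemma measurable_move [measurable]:
  fixes f :: "'a \<Rightarrow> real ^ 'n"
  assumes [measurable]: "f \<in> borel_measurable M" "w \<in> borel_measurable M"
  shows "(\<lambda>a. move \<mu> i (w a) (f a)) \<in> borel_measurable M"
proof -
  have c: "continuous_on UNIV (\<lambda>v. axis i v :: real ^ 'n)"
    unfolding axis_def
  proof (rule continuous_on_vec_lambda)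
    fix k show "continuous_on UNIV (\<lambda>v. if k = i then v else 0)" by (cases "k = i") simp_all
  qed
  have [measurable]: "(\<lambda>v. axis i v :: real ^ 'n) \<in> borel_measurable borel"
    by (rule borel_measurable_continuous_onI[OF c])
  show ?thesis unfolding move_eq_add_axis by measurable
qed

lemma measurable_abs_compose:
  assumes "continuous_on {0..} \<phi>"
  shows "(\<lambda>s :: real. \<phi> \<bar>s\<bar> :: real) \<in> borel_measurable borel"
  by (intro borel_measurable_continuous_onI continuous_on_compose2[OF assms] continuous_intros) auto

text \<open>The closed form of the probability of a set is a finite sum of integrals over the noise,
  with integrands jointly measurable in state and noise.\<close>

lemma measurable_abm_step:
  assumes \<phi>: "continuous_on {0..} \<phi>" "\<phi> \<in> {0..} \<rightarrow> {0..1}"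
    and \<nu>: "prob_space \<nu>" "sets \<nu> = sets borel"
  shows "(abm_step \<phi> \<mu> \<nu> :: real ^ 'n \<Rightarrow> _) \<in> borel \<rightarrow>\<^sub>M subprob_algebra borel"
proof (rule measurable_subprob_algebra)
  fix x :: "real ^ 'n"
  show "subprob_space (abm_step \<phi> \<mu> \<nu> x)"
    by (intro prob_space_imp_subprob_space prob_space_abm_step assms)
  show "sets (abm_step \<phi> \<mu> \<nu> x) = sets borel" by (intro sets_abm_step assms)
next
  interpret \<nu>: prob_space \<nu> by fact
  note [measurable] = measurable_abs_compose[OF \<phi>(1)]
  note [measurable_cong] = \<nu>(2)
  fix B :: "(real ^ 'n) set" assume B [measurable]: "B \<in> sets borel"
  show "(\<lambda>x. emeasure (abm_step \<phi> \<mu> \<nu> x) B) \<in> borel_measurable borel"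
    unfolding emeasure_abm_step[OF assms B] Let_def case_prod_beta by measurable
qed

text \<open>Lifts the formula from indicators to nonnegative Borel functions, so that the squared
  distance can be inserted for \<open>g\<close>.\<close>

lemma nn_integral_abm_step:
  fixes x :: "real ^ 'n"
  assumes \<phi>: "continuous_on {0..} \<phi>" "\<phi> \<in> {0..} \<rightarrow> {0..1}"
    and \<nu>: "prob_space \<nu>" "sets \<nu> = sets borel" and g: "g \<in> borel_measurable borel"
  shows "(\<integral>\<^sup>+w. g w \<partial>abm_step \<phi> \<mu> \<nu> x) =
    (\<Sum>(i, j)\<in>UNIV. (\<integral>\<^sup>+e. (let w = x $ j + e; p = \<phi> \<bar>w - x $ i\<bar> in
         ennreal p * g (move \<mu> i w x) + ennreal (1 - p) * g x) \<partial>\<nu>)) / (of_nat CARD('n))\<^sup>2"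
proof -
  note [measurable] = measurable_abs_compose[OF \<phi>(1)]
  note [measurable_cong] = \<nu>(2)
  \<comment> \<open>The mean of \<open>u\<close> after the acceptance draw, for a fixed pair and
    fixed noise. It is linear in \<open>u\<close> and commutes with increasing limits, which is what
    the induction uses.\<close>
  define H where "H u i j e = ennreal (\<phi> \<bar>x $ j + e - x $ i\<bar>) * u (move \<mu> i (x $ j + e) x)
    + ennreal (1 - \<phi> \<bar>x $ j + e - x $ i\<bar>) * u x" for u :: "real ^ 'n \<Rightarrow> ennreal" and i j e
  have H [measurable]: "H u i j \<in> borel_measurable \<nu>" if [measurable]: "u \<in> borel_measurable borel" for u i j
    unfolding H_def by measurable
  have sets [measurable_cong]: "sets (abm_step \<phi> \<mu> \<nu> x) = sets borel" by (intro sets_abm_step assms)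
  from g have "(\<integral>\<^sup>+w. g w \<partial>abm_step \<phi> \<mu> \<nu> x) =
    (\<Sum>i\<in>UNIV. \<Sum>j\<in>UNIV. \<integral>\<^sup>+e. H g i j e \<partial>\<nu>) / (of_nat CARD('n))\<^sup>2"
  proof induct
    case (cong f g)
    then have "f = g" by (auto simp: fun_eq_iff)
    with cong show ?case by simp
  next
    case (set A)
    then have "(\<integral>\<^sup>+w. indicator A w \<partial>abm_step \<phi> \<mu> \<nu> x) = emeasure (abm_step \<phi> \<mu> \<nu> x) A"
      using sets by simp
    also note emeasure_abm_step[OF \<phi> \<nu> set]
    finally show ?case unfolding H_def Let_def sum.cartesian_product UNIV_Times_UNIV .
  next
    case (mult u c)
    note [measurable] = mult(2)
    have "(\<integral>\<^sup>+e. H (\<lambda>y. c * u y) i j e \<partial>\<nu>) = c * (\<integral>\<^sup>+e. H u i j e \<partial>\<nu>)" for i j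
    proof -
      have "H (\<lambda>y. c * u y) i j e = c * H u i j e" for e
        unfolding H_def by (simp only: distrib_left mult.left_commute)
      then show ?thesis by (simp add: nn_integral_cmult)
    qed
    moreover have "(\<integral>\<^sup>+w. c * u w \<partial>abm_step \<phi> \<mu> \<nu> x) = c * (\<integral>\<^sup>+w. u w \<partial>abm_step \<phi> \<mu> \<nu> x)"
      by (rule nn_integral_cmult) measurable
    ultimately show ?case
      by (simp only: mult(4) ennreal_times_divide sum_distrib_left)
  next
    case (add u v)
    note [measurable] = add(1,4)
    have "(\<integral>\<^sup>+e. H (\<lambda>y. v y + u y) i j e \<partial>\<nu>) = (\<integral>\<^sup>+e. H v i j e \<partial>\<nu>) + (\<integral>\<^sup>+e. H u i j e \<partial>\<nu>)" for i j
    proof -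
      have "H (\<lambda>y. v y + u y) i j e = H v i j e + H u i j e" for e
        unfolding H_def by (simp only: distrib_left add.assoc add.left_commute)
      then show ?thesis by (simp add: nn_integral_add)
    qed
    moreover have "(\<integral>\<^sup>+w. v w + u w \<partial>abm_step \<phi> \<mu> \<nu> x) =
        (\<integral>\<^sup>+w. v w \<partial>abm_step \<phi> \<mu> \<nu> x) + (\<integral>\<^sup>+w. u w \<partial>abm_step \<phi> \<mu> \<nu> x)"
      by (rule nn_integral_add) measurable
    ultimately show ?case
      by (simp only: add(3) add(7) add_divide_distrib_ennreal sum.distrib)
  next
    case (seq U)
    note [measurable] = seq(1)
    have mono: "U m y \<le> U n y" if "m \<le> n" for m n y
      using seq(4) that by (auto simp: incseq_def le_fun_def)
    \<comment> \<open>The supremum has to pass through \<open>H\<close>, the noise integral and the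
      finite double sum; each exchange rests on monotonicity in \<open>n\<close>.\<close>
    have incH: "incseq (\<lambda>n. H (U n) i j)" for i j
      unfolding H_def incseq_def le_fun_def by (intro allI impI add_mono mult_left_mono mono) auto
    have "(\<integral>\<^sup>+e. H (SUP n. U n) i j e \<partial>\<nu>) = (SUP n. \<integral>\<^sup>+e. H (U n) i j e \<partial>\<nu>)" for i j
    proof -
      have "H (SUP n. U n) i j e = (SUP n. H (U n) i j e)" for e
      proof -
        have "incseq (\<lambda>n. c * U n y)" for c y
          unfolding incseq_def by (intro allI impI mult_left_mono mono) auto
        then show ?thesis
          unfolding H_def SUP_apply SUP_mult_left_ennreal by (intro ennreal_SUP_add[symmetric])
      qed
      then show ?thesis by (simp only: nn_integral_monotone_convergence_SUP[OF incH H[OF seq(1)]])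
    qed
    moreover have "(SUP n. \<Sum>i\<in>UNIV. \<Sum>j\<in>UNIV. \<integral>\<^sup>+e. H (U n) i j e \<partial>\<nu>)
        = (\<Sum>i\<in>UNIV. \<Sum>j\<in>UNIV. SUP n. \<integral>\<^sup>+e. H (U n) i j e \<partial>\<nu>)"
    proof -
      have inc: "incseq (\<lambda>n. \<integral>\<^sup>+e. H (U n) i j e \<partial>\<nu>)" for i j
        using incH[of i j] unfolding incseq_def le_fun_def by (blast intro: nn_integral_mono)
      have "incseq (\<lambda>n. \<Sum>j\<in>UNIV. \<integral>\<^sup>+e. H (U n) i j e \<partial>\<nu>)" for i
        using inc unfolding incseq_def by (blast intro: sum_mono)
      then show ?thesis by (simp only: ennreal_SUP_sum inc)
    qed
    moreover have "(\<integral>\<^sup>+w. (SUP n. U n) w \<partial>abm_step \<phi> \<mu> \<nu> x) = (SUP n. \<integral>\<^sup>+w. U n w \<partial>abm_step \<phi> \<mu> \<nu> x)"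
      unfolding SUP_apply using seq(4) by (intro nn_integral_monotone_convergence_SUP) auto
    ultimately show ?case
      by (simp only: seq(3) SUP_divide_ennreal[symmetric])
  qed
  then show ?thesis unfolding H_def Let_def sum.cartesian_product UNIV_Times_UNIV .
qed

section \<open>Markov chains\<close>

lemma measurable_history_component:
  assumes "k \<le> n"
  shows "x k \<in> history M x n \<rightarrow>\<^sub>M borel"
proof -
  have "(\<lambda>\<omega>. \<lambda>k\<in>{..n}. x k \<omega>) \<in> history M x n \<rightarrow>\<^sub>M (\<Pi>\<^sub>M k\<in>{..n}. borel)"
    unfolding history_def by (rule measurable_vimage_algebra1) (auto simp: space_PiM)
  from measurable_compose[OF this measurable_component_singleton[of k]] assms
  show ?thesis by simp
qed

lemma subalgebra_history:
  assumes "\<And>k. x k \<in> borel_measurable M"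
  shows "subalgebra M (history M x n)"
proof -
  have "(\<lambda>\<omega>. \<lambda>k\<in>{..n}. x k \<omega>) \<in> M \<rightarrow>\<^sub>M (\<Pi>\<^sub>M k\<in>{..n}. borel)"
    by (intro measurable_restrict assms)
  then show ?thesis
    by (simp add: subalgebra_def history_def measurable_iff_sets)
qed

text \<open>The defining property treats one set \<open>B\<close> at a time, with a null set
  depending on \<open>B\<close>. Comparing measures on the state space avoids uniting these null
  sets: the law of the next state on \<open>F\<close> and the mixture of the kernels over
  \<open>F\<close> agree on every Borel set, hence in all integrals.\<close>

lemma nn_integral_markov_chain_Suc:
  assumes chain: "markov_chain M K s x" and K: "K \<in> borel \<rightarrow>\<^sub>M subprob_algebra borel"
    and F: "F \<in> sets (history M x n)" and g: "g \<in> borel_measurable borel"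
  shows "(\<integral>\<^sup>+\<omega>. indicator F \<omega> * g (x (Suc n) \<omega>) \<partial>M) =
    (\<integral>\<^sup>+\<omega>. indicator F \<omega> * (\<integral>\<^sup>+w. g w \<partial>K (x n \<omega>)) \<partial>M)"
proof -
  interpret prob_space M using chain by (simp add: markov_chain_def)
  have x [measurable]: "x k \<in> borel_measurable M" for k using chain by (simp add: markov_chain_def)
  note sub = subalgebra_history[of x M n, OF x]
  interpret finite_measure_subalgebra M "history M x n" by standard (rule sub)
  have F' [measurable]: "F \<in> sets M" using F sub by (auto simp: subalgebra_def)
  note [measurable] = K
  \<comment> \<open>Restricting \<open>M\<close> to \<open>F\<close> turns integrals over
    \<open>F\<close> into plain integrals and the mixture of the kernels into a bind.\<close>
  define D where "D = density M (indicator F)"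
  have [measurable_cong]: "sets D = sets M" by (simp add: D_def)
  have sp: "space D = space M" "space M \<noteq> {}" by (auto simp: D_def not_empty)
  have Kx: "(\<lambda>\<omega>. K (x n \<omega>)) \<in> D \<rightarrow>\<^sub>M subprob_algebra borel" by measurable
  have "distr D borel (x (Suc n)) = D \<bind> (\<lambda>\<omega>. K (x n \<omega>))"
  proof (rule measure_eqI)
    have "sets (D \<bind> (\<lambda>\<omega>. K (x n \<omega>))) = sets borel"
      using sp by (intro sets_bind_measurable[OF Kx]) auto
    then show "sets (distr D borel (x (Suc n))) = sets (D \<bind> (\<lambda>\<omega>. K (x n \<omega>)))" by simp
    fix B assume "B \<in> sets (distr D borel (x (Suc n)))"
    then have B [measurable]: "B \<in> sets borel" by simp
    have Ks: "subprob_space (K y)" "sets (K y) = sets borel" for y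
      using measurable_space[OF K, of y] by (auto simp: space_subprob_algebra)
    have le1: "measure (K y) B \<le> 1" for y by (rule subprob_space.subprob_measure_le_1[OF Ks(1)])
    have m: "(\<lambda>\<omega>. measure (K (x n \<omega>)) B) \<in> borel_measurable M" by measurable
    \<comment> \<open>Averaging over the history event \<open>F\<close> replaces the indicator by
      its conditional expectation, and the Markov property replaces that by the kernel.\<close>
    have "(\<integral>\<omega>. indicator F \<omega> * indicator B (x (Suc n) \<omega>) \<partial>M)
       = (\<integral>\<omega>. indicator F \<omega> * real_cond_exp M (history M x n) (\<lambda>\<omega>. indicator B (x (Suc n) \<omega>)) \<omega> \<partial>M)"
      using real_cond_exp_intA[OF _ F, of "\<lambda>\<omega>. indicator B (x (Suc n) \<omega>)"]
      by (simp add: set_lebesgue_integral_def integrable_const_bound[where B=1])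
    also have "\<dots> = (\<integral>\<omega>. indicator F \<omega> * measure (K (x n \<omega>)) B \<partial>M)"
    proof (rule integral_cong_AE)
      have "AE \<omega> in M. real_cond_exp M (history M x n) (\<lambda>\<omega>. indicator B (x (Suc n) \<omega>)) \<omega> = measure (K (x n \<omega>)) B"
        using chain B unfolding markov_chain_def by blast
      then show "AE \<omega> in M. indicator F \<omega> * real_cond_exp M (history M x n) (\<lambda>\<omega>. indicator B (x (Suc n) \<omega>)) \<omega>
          = indicator F \<omega> * measure (K (x n \<omega>)) B" by eventually_elim simp
    qed (use m in measurable)
    finally have eq: "(\<integral>\<omega>. indicator F \<omega> * indicator B (x (Suc n) \<omega>) \<partial>M)
      = (\<integral>\<omega>. indicator F \<omega> * measure (K (x n \<omega>)) B \<partial>M)" .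
    have "emeasure (distr D borel (x (Suc n))) B = (\<integral>\<^sup>+w. indicator B w \<partial>distr D borel (x (Suc n)))"
      by simp
    also have "\<dots> = (\<integral>\<^sup>+\<omega>. indicator B (x (Suc n) \<omega>) \<partial>D)"
      by (rule nn_integral_distr) measurable
    also have "\<dots> = (\<integral>\<^sup>+\<omega>. ennreal (indicator F \<omega> * indicator B (x (Suc n) \<omega>)) \<partial>M)"
      unfolding D_def by (subst nn_integral_density) (auto simp: ennreal_mult ennreal_indicator)
    also have "\<dots> = ennreal (\<integral>\<omega>. indicator F \<omega> * indicator B (x (Suc n) \<omega>) \<partial>M)"
      by (intro nn_integral_eq_integral integrable_const_bound[where B=1]) (auto simp: indicator_def)
    also have "\<dots> = (\<integral>\<^sup>+\<omega>. ennreal (indicator F \<omega> * measure (K (x n \<omega>)) B) \<partial>M)"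
      unfolding eq using m le1
      by (intro nn_integral_eq_integral[symmetric] integrable_const_bound[where B=1]) (auto simp: indicator_def)
    also have "\<dots> = (\<integral>\<^sup>+\<omega>. emeasure (K (x n \<omega>)) B \<partial>D)"
      unfolding D_def using m
      by (subst nn_integral_density)
        (auto simp: ennreal_mult ennreal_indicator finite_measure.emeasure_eq_measure[OF subprob_space.axioms(1)[OF Ks(1)]])
    also have "\<dots> = emeasure (D \<bind> (\<lambda>\<omega>. K (x n \<omega>))) B"
      using sp by (intro emeasure_bind[OF _ Kx B, symmetric]) auto
    finally show "emeasure (distr D borel (x (Suc n))) B = emeasure (D \<bind> (\<lambda>\<omega>. K (x n \<omega>))) B" .
  qed
  then have "(\<integral>\<^sup>+w. g w \<partial>distr D borel (x (Suc n))) = (\<integral>\<^sup>+w. g w \<partial>(D \<bind> (\<lambda>\<omega>. K (x n \<omega>))))" by simp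
  also have "\<dots> = (\<integral>\<^sup>+\<omega>. \<integral>\<^sup>+w. g w \<partial>K (x n \<omega>) \<partial>D)" by (rule nn_integral_bind[OF g Kx])
  also have "(\<integral>\<^sup>+w. g w \<partial>distr D borel (x (Suc n))) = (\<integral>\<^sup>+\<omega>. g (x (Suc n) \<omega>) \<partial>D)"
    using g by (intro nn_integral_distr) measurable
  finally show ?thesis
    using g nn_integral_measurable_subprob_algebra2[of "\<lambda>_. g" borel borel K]
    unfolding D_def by (subst (asm) (1 2) nn_integral_density) (auto simp: case_prod_beta)
qed

text \<open>The process stopped when \<open>V\<close> reaches \<open>a\<close> dominates \<open>a\<close> times the indicator of the event.\<close>

lemma markov_chain_maximal_inequality:
  fixes V :: "nat \<Rightarrow> 's::topological_space \<Rightarrow> real"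
  assumes chain: "markov_chain M K s x" and K: "K \<in> borel \<rightarrow>\<^sub>M subprob_algebra borel"
    and V [measurable]: "\<And>n. V n \<in> borel_measurable borel" and V0: "V 0 s = 0" and Vpos: "\<And>n y. 0 \<le> V n y"
    and q: "1 \<le> q" and \<epsilon>: "0 \<le> \<epsilon>" and a: "0 < a"
    and step: "\<And>n y. n < m \<Longrightarrow> (\<integral>\<^sup>+w. ennreal (V (Suc n) w) \<partial>K y) \<le> ennreal (q * V n y + \<epsilon>)"
  shows "measure M {\<omega>\<in>space M. \<exists>k\<le>m. a \<le> V k (x k \<omega>)} \<le> q ^ m * (real m * \<epsilon>) / a"
proof -
  interpret prob_space M using chain by (simp add: markov_chain_def)
  have x [measurable]: "x k \<in> borel_measurable M" for k using chain by (simp add: markov_chain_def)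
  \<comment> \<open>After a crossing the value is frozen at \<open>a\<close>, not at the value
    reached. At the crossing time itself \<Phi> still shows the overshoot; it drops to
    \<open>a\<close> one step later.\<close>
  define \<Phi> where "\<Phi> n \<omega> = (if \<forall>k<n. V k (x k \<omega>) < a then V n (x n \<omega>) else a)" for n \<omega>
  have [measurable]: "\<Phi> n \<in> borel_measurable M" for n unfolding \<Phi>_def by measurable
  have \<Phi>pos: "0 \<le> \<Phi> n \<omega>" for n \<omega> using a Vpos by (auto simp: \<Phi>_def)
  have E: "(\<integral>\<^sup>+\<omega>. \<Phi> n \<omega> \<partial>M) \<le> ennreal (q ^ n * (real n * \<epsilon>))" if "n \<le> m" for n
    using that
  proof (induction n)
    case 0
    have "AE \<omega> in M. \<Phi> 0 \<omega> = 0"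
      using chain V0 by (auto simp: markov_chain_def \<Phi>_def)
    then have "(\<integral>\<^sup>+\<omega>. \<Phi> 0 \<omega> \<partial>M) = (\<integral>\<^sup>+\<omega>. 0 \<partial>M)" by (intro nn_integral_cong_AE) auto
    then show ?case by simp
  next
    case (Suc n)
    \<comment> \<open>No crossing up to and including time \<open>n\<close>: an event of the
      history, over which the one-step estimate may be integrated.\<close>
    define F where "F = {\<omega>\<in>space (history M x n). \<forall>k\<in>{..n}. V k (x k \<omega>) < a}"
    have sp: "space (history M x n) = space M" by (simp add: history_def)
    have "{\<omega>\<in>space (history M x n). V k (x k \<omega>) < a} \<in> sets (history M x n)" if "k \<in> {..n}" for k
      using measurable_compose[OF measurable_history_component[of k n x M] V[of k]] that by simp
    then have F: "F \<in> sets (history M x n)"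
      unfolding F_def by (intro sets.sets_Collect_finite_All') auto
    have FM [measurable]: "F \<in> sets M" unfolding F_def sp by measurable
    have FI: "\<omega> \<in> F \<longleftrightarrow> (\<forall>k<Suc n. V k (x k \<omega>) < a)" if "\<omega> \<in> space M" for \<omega>
      using that by (auto simp: F_def sp less_Suc_eq_le)
    have "(\<integral>\<^sup>+\<omega>. \<Phi> (Suc n) \<omega> \<partial>M) =
        (\<integral>\<^sup>+\<omega>. indicator F \<omega> * ennreal (V (Suc n) (x (Suc n) \<omega>)) + ennreal a * indicator (space M - F) \<omega> \<partial>M)"
      by (intro nn_integral_cong) (auto simp: \<Phi>_def FI split: split_indicator)
    also have "\<dots> = (\<integral>\<^sup>+\<omega>. indicator F \<omega> * ennreal (V (Suc n) (x (Suc n) \<omega>)) \<partial>M) + 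
        (\<integral>\<^sup>+\<omega>. ennreal a * indicator (space M - F) \<omega> \<partial>M)"
      by (rule nn_integral_add) measurable
    also have "(\<integral>\<^sup>+\<omega>. indicator F \<omega> * ennreal (V (Suc n) (x (Suc n) \<omega>)) \<partial>M) = 
        (\<integral>\<^sup>+\<omega>. indicator F \<omega> * (\<integral>\<^sup>+w. ennreal (V (Suc n) w) \<partial>K (x n \<omega>)) \<partial>M)"
      by (rule nn_integral_markov_chain_Suc[OF chain K F]) measurable
    also have "\<dots> \<le> (\<integral>\<^sup>+\<omega>. indicator F \<omega> * ennreal (q * V n (x n \<omega>) + \<epsilon>) \<partial>M)"
      using Suc.prems by (intro nn_integral_mono mult_left_mono step) auto
    also have "\<dots> + (\<integral>\<^sup>+\<omega>. ennreal a * indicator (space M - F) \<omega> \<partial>M)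
       = (\<integral>\<^sup>+\<omega>. indicator F \<omega> * ennreal (q * V n (x n \<omega>) + \<epsilon>) + ennreal a * indicator (space M - F) \<omega> \<partial>M)"
      by (rule nn_integral_add[symmetric]) measurable
    also have "\<dots> \<le> (\<integral>\<^sup>+\<omega>. ennreal q * ennreal (\<Phi> n \<omega>) + ennreal \<epsilon> \<partial>M)"
    proof (rule nn_integral_mono)
      fix \<omega> assume \<omega>: "\<omega> \<in> space M"
      have "ennreal q * ennreal (\<Phi> n \<omega>) + ennreal \<epsilon> = ennreal (q * \<Phi> n \<omega> + \<epsilon>)"
        using q \<epsilon> \<Phi>pos[of n \<omega>] by (simp add: ennreal_mult)
      moreover have "a \<le> q * \<Phi> n \<omega> + \<epsilon>" if "\<omega> \<notin> F"
      proof -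
        have "a \<le> \<Phi> n \<omega>" using that \<omega> by (auto simp: FI \<Phi>_def less_Suc_eq not_less)
        also have "\<dots> \<le> q * \<Phi> n \<omega>" using q \<Phi>pos[of n \<omega>] by (simp add: mult_le_cancel_right1)
        finally show ?thesis using \<epsilon> by simp
      qed
      moreover have "\<Phi> n \<omega> = V n (x n \<omega>)" if "\<omega> \<in> F"
        using that \<omega> by (auto simp: FI \<Phi>_def)
      ultimately show "indicator F \<omega> * ennreal (q * V n (x n \<omega>) + \<epsilon>) + ennreal a * indicator (space M - F) \<omega>
        \<le> ennreal q * ennreal (\<Phi> n \<omega>) + ennreal \<epsilon>"
        using \<omega> by (cases "\<omega> \<in> F") (auto intro: ennreal_leI)
    qed
    also have "\<dots> = ennreal q * (\<integral>\<^sup>+\<omega>. \<Phi> n \<omega> \<partial>M) + ennreal \<epsilon>"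
      by (simp add: nn_integral_add nn_integral_cmult emeasure_space_1)
    also have "\<dots> \<le> ennreal q * ennreal (q ^ n * (real n * \<epsilon>)) + ennreal \<epsilon>"
      using Suc by (intro add_mono mult_left_mono) auto
    also have "\<dots> = ennreal (q ^ Suc n * (real n * \<epsilon>) + \<epsilon>)"
      using q \<epsilon> by (simp add: ennreal_mult[symmetric] ennreal_plus[symmetric] ac_simps del: ennreal_plus)
    \<comment> \<open>Inflating the new \<epsilon> by q^(n+1) \<ge> 1 replaces a geometric sum by a
      linear factor.\<close>
    also have "\<dots> \<le> ennreal (q ^ Suc n * (real (Suc n) * \<epsilon>))"
    proof (rule ennreal_leI)
      have "1 * \<epsilon> \<le> q ^ Suc n * \<epsilon>" using q \<epsilon> by (intro mult_right_mono one_le_power) auto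
      then show "q ^ Suc n * (real n * \<epsilon>) + \<epsilon> \<le> q ^ Suc n * (real (Suc n) * \<epsilon>)"
        by (simp add: algebra_simps)
    qed
    finally show ?case by (simp add: add_right_mono)
  qed
  let ?S = "{\<omega>\<in>space M. \<exists>k\<le>m. a \<le> V k (x k \<omega>)}"
  have "ennreal (a * measure M ?S) = ennreal a * emeasure M ?S"
    using a by (simp add: ennreal_mult emeasure_eq_measure)
  also have "\<dots> = (\<integral>\<^sup>+\<omega>. ennreal a * indicator ?S \<omega> \<partial>M)"
    by (rule nn_integral_cmult_indicator[symmetric]) measurable
  also have "\<dots> \<le> (\<integral>\<^sup>+\<omega>. \<Phi> m \<omega> \<partial>M)"
  proof (rule nn_integral_mono)
    fix \<omega>
    have "a \<le> \<Phi> m \<omega>" if "\<omega> \<in> ?S" using that by (force simp: \<Phi>_def le_less)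
    then show "ennreal a * indicator ?S \<omega> \<le> ennreal (\<Phi> m \<omega>)"
      by (auto intro: ennreal_leI split: split_indicator)
  qed
  also have "\<dots> \<le> ennreal (q ^ m * (real m * \<epsilon>))" by (rule E) simp
  finally have "a * measure M ?S \<le> q ^ m * (real m * \<epsilon>)"
    using q \<epsilon> by (subst (asm) ennreal_le_iff) auto
  then show ?thesis using a by (simp add: field_simps)
qed

text \<open>Only \<open>y\<close> has to be bounded, so the chain needs no localization. Up to the remainder \<open>\<rho>\<close>,
  the first-order terms complete the square: the drift of \<open>y\<close> cancels.\<close>

lemma abm_step_mean_square_le:
  fixes x y z :: "real ^ 'n"
  assumes \<phi>: "L-lipschitz_on {0..} \<phi>" "\<phi> \<in> {0..} \<rightarrow> {0..1}"
    and \<nu>: "prob_space \<nu>" "sets \<nu> = sets borel"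
    and int: "integrable \<nu> (\<lambda>e. \<bar>e\<bar>)" "integrable \<nu> (\<lambda>e. e\<^sup>2)"
    and \<delta>: "(\<integral>e. \<bar>e\<bar> \<partial>\<nu>) \<le> \<delta>" "\<delta> \<le> 1" and C: "(\<integral>e. e\<^sup>2 \<partial>\<nu>) \<le> C"
    and y: "norm y \<le> r" and h: "0 < h" "h \<le> 1" and c: "0 \<le> c"
    and z: "norm (z - y) \<le> c * h" "norm (z - y - h *\<^sub>R drift \<phi> y) \<le> c * h\<^sup>2"
  defines "N \<equiv> real CARD('n)" and "A \<equiv> 1 + 2 * L * r"
  shows "(\<integral>\<^sup>+w. ennreal ((norm (w - z))\<^sup>2) \<partial>abm_step \<phi> (N * h) \<nu> x) \<le>
    ennreal ((1 + (c + 2 * N * A * (3 + c) + 16 * N\<^sup>2) * h) * (norm (x - y))\<^sup>2 +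
      h * (c * h + c\<^sup>2 * h + 2 * N * A * (\<delta> + c * h + \<delta> * c * h) + N\<^sup>2 * h * (16 * r\<^sup>2 + 2 * C)))"
    (is "_ \<le> ennreal ?bound")
proof -
  interpret \<nu>: prob_space \<nu> by fact
  note [measurable_cong] = \<nu>(2)
  \<comment> \<open>In the application \<open>x\<close> is the state of the chain, \<open>y\<close>
    the limit at the same time and \<open>z\<close> the limit one step later.\<close>
  define d where "d = norm (x - y)"
  define \<mu> where "\<mu> = N * h"
  define \<psi> where "\<psi> s = \<phi> \<bar>s\<bar> * s" for s
  define k where "k = d + c * h"
  have L: "0 \<le> L" by (rule lipschitz_on_nonneg[OF \<phi>(1)])
  have r: "0 \<le> r" using y norm_ge_zero[of y] by linarith
  have A: "0 \<le> A" using L r by (simp add: A_def)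
  have N: "0 < N" by (simp add: N_def)
  have \<mu>: "0 \<le> \<mu>" using N h by (simp add: \<mu>_def)
  have d: "0 \<le> d" by (simp add: d_def)
  have p: "0 \<le> \<phi> \<bar>s\<bar>" "\<phi> \<bar>s\<bar> \<le> 1" for s using \<phi>(2) by (auto simp: Pi_iff)
  have xz: "norm (x - z) \<le> k"
    using norm_triangle_ineq4[of "x - y" "z - y"] z(1) by (simp add: k_def d_def)
  have \<delta>0: "0 \<le> \<delta>" by (rule order.trans[OF Bochner_Integration.integral_nonneg \<delta>(1)]) simp
  \<comment> \<open>A bound for the mean given the pair and the noise, with slots \<open>a\<close>
    and \<open>b\<close> for \<open>\<bar>e\<bar>\<close> and \<open>e\<^sup>2\<close>. It is affine
    in both, so integrating over the noise merely substitutes the moments. The cross term already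
    has \<open>y\<close> instead of \<open>x\<close> in the interaction; the term with
    \<open>A\<close> pays for this.\<close>
  define G where "G a b i j = (norm (x - z))\<^sup>2 + 2 * \<mu> * \<psi> (y $ j - y $ i) * (x - z) $ i
      + 2 * \<mu> * A * (2 * d + a) * k + \<mu>\<^sup>2 * (2 * (2 * d + 2 * r)\<^sup>2 + 2 * b)" for a b i j
  have path: "\<phi> \<bar>x $ j + e - x $ i\<bar> * (norm (move \<mu> i (x $ j + e) x - z))\<^sup>2
      + (1 - \<phi> \<bar>x $ j + e - x $ i\<bar>) * (norm (x - z))\<^sup>2 \<le> G \<bar>e\<bar> (e\<^sup>2) i j" for e i j
  proof -
    define s where "s = x $ j + e - x $ i"
    define v where "v = y $ j - y $ i"
    have v: "\<bar>v\<bar> \<le> 2 * r" using abs_diff_component_le[of y j i] y by (simp add: v_def)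
    have sv: "\<bar>s - v\<bar> \<le> 2 * d + \<bar>e\<bar>"
      using abs_diff_component_le[of "x - y" j i] by (simp add: s_def v_def d_def)
    have "\<bar>\<psi> s - \<psi> v\<bar> \<le> (1 + L * \<bar>v\<bar>) * \<bar>s - v\<bar>"
      unfolding \<psi>_def by (rule interaction_diff_le[OF \<phi>])
    also have "\<dots> \<le> A * (2 * d + \<bar>e\<bar>)"
    proof (intro mult_mono sv A)
      show "1 + L * \<bar>v\<bar> \<le> A" unfolding A_def using mult_left_mono[OF v L] by simp
    qed auto
    finally have "\<bar>\<psi> s - \<psi> v\<bar> \<le> A * (2 * d + \<bar>e\<bar>)" .
    moreover have "\<bar>(x - z) $ i\<bar> \<le> k" using component_le_norm_cart[of "x - z" i] xz by linarith
    ultimately have "\<bar>\<psi> s - \<psi> v\<bar> * \<bar>(x - z) $ i\<bar> \<le> (A * (2 * d + \<bar>e\<bar>)) * k"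
      using A d by (intro mult_mono) auto
    then have "(\<psi> s - \<psi> v) * (x - z) $ i \<le> (A * (2 * d + \<bar>e\<bar>)) * k"
      using abs_ge_self[of "(\<psi> s - \<psi> v) * (x - z) $ i"] by (simp only: abs_mult)
    then have 1: "2 * \<mu> * ((\<psi> s - \<psi> v) * (x - z) $ i) \<le> 2 * \<mu> * ((A * (2 * d + \<bar>e\<bar>)) * k)"
      using \<mu> by (intro mult_left_mono) auto
    have "\<bar>x $ j - x $ i\<bar> \<le> 2 * d + 2 * r"
      using abs_diff_component_le[of "x - y" j i] v by (simp add: v_def d_def)
    then have "(x $ j - x $ i)\<^sup>2 \<le> (2 * d + 2 * r)\<^sup>2"
      using d r by (intro power2_le_iff_abs_le[THEN iffD2]) auto
    moreover have "s\<^sup>2 \<le> 2 * (x $ j - x $ i)\<^sup>2 + 2 * e\<^sup>2"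
      using sum_squares_bound[of "x $ j - x $ i" e] unfolding s_def
      by (simp add: power2_eq_square algebra_simps)
    ultimately have "s\<^sup>2 \<le> 2 * (2 * d + 2 * r)\<^sup>2 + 2 * e\<^sup>2" by linarith
    then have "\<phi> \<bar>s\<bar> * s\<^sup>2 \<le> 1 * (2 * (2 * d + 2 * r)\<^sup>2 + 2 * e\<^sup>2)"
      using p by (intro mult_mono) auto
    then have 2: "\<mu>\<^sup>2 * (\<phi> \<bar>s\<bar> * s\<^sup>2) \<le> \<mu>\<^sup>2 * (2 * (2 * d + 2 * r)\<^sup>2 + 2 * e\<^sup>2)"
      by (intro mult_left_mono) auto
    have "\<phi> \<bar>s\<bar> * (norm (move \<mu> i (x $ j + e) x - z))\<^sup>2 + (1 - \<phi> \<bar>s\<bar>) * (norm (x - z))\<^sup>2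
       = (norm (x - z))\<^sup>2 + 2 * \<mu> * (\<psi> s * (x - z) $ i) + \<mu>\<^sup>2 * (\<phi> \<bar>s\<bar> * s\<^sup>2)"
      unfolding norm_move_diff_square s_def[symmetric] \<psi>_def by (simp add: algebra_simps)
    with 1 2 show ?thesis unfolding G_def s_def[symmetric] v_def[symmetric] by (simp add: algebra_simps)
  qed
  have G0: "0 \<le> G \<bar>e\<bar> (e\<^sup>2) i j" for e i j
    using path[of j e i] p[of "x $ j + e - x $ i"] by (smt (verit) mult_nonneg_nonneg zero_le_power2)
  have Gint: "integrable \<nu> (\<lambda>e. G \<bar>e\<bar> (e\<^sup>2) i j)" for i j
    unfolding G_def using int by auto
  have GE: "(\<integral>e. G \<bar>e\<bar> (e\<^sup>2) i j \<partial>\<nu>) = G (\<integral>e. \<bar>e\<bar> \<partial>\<nu>) (\<integral>e. e\<^sup>2 \<partial>\<nu>) i j" for i j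
    unfolding G_def using int by (simp add: \<nu>.prob_space)
  have Gle: "G (\<integral>e. \<bar>e\<bar> \<partial>\<nu>) (\<integral>e. e\<^sup>2 \<partial>\<nu>) i j \<le> G \<delta> C i j" for i j
  proof -
    have "0 \<le> k" using d c h by (simp add: k_def)
    then show ?thesis
      unfolding G_def using \<mu> A \<delta> C by (intro add_mono mult_left_mono mult_right_mono order.refl) auto
  qed
  have pair_le: "(\<integral>\<^sup>+e. (let w = x $ j + e; p = \<phi> \<bar>w - x $ i\<bar> in
         ennreal p * ennreal ((norm (move \<mu> i w x - z))\<^sup>2) + ennreal (1 - p) * ennreal ((norm (x - z))\<^sup>2)) \<partial>\<nu>)
       \<le> ennreal (G \<delta> C i j)" for i j
  proof -
    have "(\<integral>\<^sup>+e. (let w = x $ j + e; p = \<phi> \<bar>w - x $ i\<bar> in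
         ennreal p * ennreal ((norm (move \<mu> i w x - z))\<^sup>2) + ennreal (1 - p) * ennreal ((norm (x - z))\<^sup>2)) \<partial>\<nu>)
       \<le> (\<integral>\<^sup>+e. ennreal (G \<bar>e\<bar> (e\<^sup>2) i j) \<partial>\<nu>)"
      unfolding Let_def using p
      by (intro nn_integral_mono)
        (simp add: ennreal_mult[symmetric] ennreal_plus[symmetric] path ennreal_leI del: ennreal_plus)
    also have "\<dots> = ennreal (\<integral>e. G \<bar>e\<bar> (e\<^sup>2) i j \<partial>\<nu>)"
      by (rule nn_integral_eq_integral[OF Gint]) (simp add: G0)
    also have "\<dots> \<le> ennreal (G \<delta> C i j)" unfolding GE by (rule ennreal_leI[OF Gle])
    finally show ?thesis .
  qed
  have GC0: "0 \<le> G \<delta> C i j" for i j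
    by (rule order.trans[OF Bochner_Integration.integral_nonneg[where M = \<nu> and f = "\<lambda>e. G \<bar>e\<bar> (e\<^sup>2) i j"]])
      (use G0 Gle[of i j] in \<open>auto simp: GE\<close>)
  \<comment> \<open>Averaging over the pairs puts 2 \<mu> N / N^2 = 2 h in front of the drift: here
    the choice \<mu> = N h is used.\<close>
  have sumG: "(\<Sum>(i, j)\<in>UNIV. G \<delta> C i j) / N\<^sup>2 =
      (norm (x - z))\<^sup>2 + 2 * h * (drift \<phi> y \<bullet> (x - z)) + 2 * \<mu> * A * (2 * d + \<delta>) * k
      + \<mu>\<^sup>2 * (2 * (2 * d + 2 * r)\<^sup>2 + 2 * C)"
  proof -
    have "N * (drift \<phi> y \<bullet> (x - z)) = (\<Sum>i\<in>UNIV. \<Sum>j\<in>UNIV. \<psi> (y $ j - y $ i) * (x - z) $ i)"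
      unfolding inner_vec_def drift_def \<psi>_def N_def
      by (simp add: sum_distrib_right sum_distrib_left sum_divide_distrib)
    then have "(\<Sum>i\<in>UNIV. \<Sum>j\<in>UNIV. 2 * \<mu> * \<psi> (y $ j - y $ i) * (x - z) $ i) = 2 * \<mu> * (N * (drift \<phi> y \<bullet> (x - z)))"
      by (simp only: sum_distrib_left mult.assoc)
    moreover have "(\<Sum>(i, j)\<in>UNIV. G \<delta> C i j) = (\<Sum>i\<in>UNIV. \<Sum>j\<in>UNIV. G \<delta> C i j)"
      by (simp add: sum.cartesian_product)
    ultimately have "(\<Sum>(i, j)\<in>UNIV. G \<delta> C i j) = N\<^sup>2 * (norm (x - z))\<^sup>2 + 2 * \<mu> * (N * (drift \<phi> y \<bullet> (x - z)))
      + N\<^sup>2 * (2 * \<mu> * A * (2 * d + \<delta>) * k) + N\<^sup>2 * (\<mu>\<^sup>2 * (2 * (2 * d + 2 * r)\<^sup>2 + 2 * C))"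
      unfolding G_def by (simp add: sum.distrib N_def[symmetric] power2_eq_square mult.assoc)
    then show ?thesis using N by (simp add: \<mu>_def field_simps power2_eq_square)
  qed
  \<comment> \<open>The square of x - z + h drift exceeds the left side by h^2 |drift|^2, and this
    vector is x - y minus the Euler error of \<open>z\<close>.\<close>
  have sq: "(norm (x - z))\<^sup>2 + 2 * h * (drift \<phi> y \<bullet> (x - z)) \<le> (d + c * h\<^sup>2)\<^sup>2"
  proof -
    have "norm ((x - z) + h *\<^sub>R drift \<phi> y) \<le> norm (x - y) + norm (z - y - h *\<^sub>R drift \<phi> y)"
      using norm_triangle_ineq4[of "x - y" "z - y - h *\<^sub>R drift \<phi> y"] by (simp add: algebra_simps)
    then have "(norm ((x - z) + h *\<^sub>R drift \<phi> y))\<^sup>2 \<le> (d + c * h\<^sup>2)\<^sup>2"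
      using z(2) by (intro power_mono) (auto simp: d_def)
    moreover have "(norm ((x - z) + h *\<^sub>R drift \<phi> y))\<^sup>2 =
        (norm (x - z))\<^sup>2 + 2 * h * (drift \<phi> y \<bullet> (x - z)) + h\<^sup>2 * (norm (drift \<phi> y))\<^sup>2"
      unfolding power2_norm_eq_inner
      by (simp add: inner_add_left inner_add_right inner_commute power2_eq_square algebra_simps)
    ultimately show ?thesis by (smt (verit) mult_nonneg_nonneg zero_le_power2)
  qed
  have bound: "(d + c * h\<^sup>2)\<^sup>2 + 2 * \<mu> * A * (2 * d + \<delta>) * k + \<mu>\<^sup>2 * (2 * (2 * d + 2 * r)\<^sup>2 + 2 * C) \<le> ?bound"
  proof -
    \<comment> \<open>In the first two blocks, terms linear in \<open>d\<close> are split by 2 d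
      \<le> 1 + d^2 or d \<le> 1 + d^2. Each carries \<delta> or a power of \<open>h\<close>, so the
      constant part joins the vanishing remainder and the square part the growth rate.\<close>
    have d1: "2 * d \<le> 1 + d\<^sup>2" "d \<le> 1 + d\<^sup>2"
      using sum_squares_bound[of d 1] d by auto
    have hh: "h\<^sup>2 \<le> h" "h\<^sup>2 * h\<^sup>2 \<le> h\<^sup>2" using h by (auto simp: power2_eq_square mult_le_one mult_left_le)
    have "(d + c * h\<^sup>2)\<^sup>2 = d\<^sup>2 + c * h\<^sup>2 * (2 * d) + c\<^sup>2 * (h\<^sup>2 * h\<^sup>2)"
      by (simp add: power2_eq_square algebra_simps)
    also have "\<dots> \<le> d\<^sup>2 + c * h\<^sup>2 * (1 + d\<^sup>2) + c\<^sup>2 * h\<^sup>2"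
      using d1 hh c by (intro add_mono mult_left_mono) auto
    also have "\<dots> = d\<^sup>2 + c * h\<^sup>2 * d\<^sup>2 + c * h\<^sup>2 + c\<^sup>2 * h\<^sup>2" by (simp add: algebra_simps)
    also have "\<dots> \<le> d\<^sup>2 + c * h * d\<^sup>2 + c * h\<^sup>2 + c\<^sup>2 * h\<^sup>2"
      using hh c by (intro add_mono mult_right_mono mult_left_mono) auto
    finally have 1: "(d + c * h\<^sup>2)\<^sup>2 \<le> d\<^sup>2 + c * h * d\<^sup>2 + c * h\<^sup>2 + c\<^sup>2 * h\<^sup>2" .
    have "(2 * d + \<delta>) * k = 2 * d\<^sup>2 + \<delta> * d + c * h * (2 * d) + \<delta> * c * h"
      by (simp add: k_def power2_eq_square algebra_simps)
    also have "\<dots> \<le> 2 * d\<^sup>2 + \<delta> * (1 + d\<^sup>2) + c * h * (1 + d\<^sup>2) + \<delta> * c * h"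
      using d1 c h \<delta>0 by (intro add_mono mult_left_mono) auto
    also have "\<dots> = 2 * d\<^sup>2 + \<delta> * d\<^sup>2 + c * (h * d\<^sup>2) + (\<delta> + c * h + \<delta> * c * h)" by (simp add: algebra_simps)
    also have "\<dots> \<le> 2 * d\<^sup>2 + 1 * d\<^sup>2 + c * (1 * d\<^sup>2) + (\<delta> + c * h + \<delta> * c * h)"
      using c h \<delta> by (intro add_mono mult_left_mono mult_right_mono) auto
    finally have "(2 * d + \<delta>) * k \<le> (3 + c) * d\<^sup>2 + (\<delta> + c * h + \<delta> * c * h)" by (simp add: algebra_simps)
    then have "2 * \<mu> * A * ((2 * d + \<delta>) * k) \<le> 2 * \<mu> * A * ((3 + c) * d\<^sup>2 + (\<delta> + c * h + \<delta> * c * h))"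
      using \<mu> A by (intro mult_left_mono) auto
    then have 2: "2 * \<mu> * A * (2 * d + \<delta>) * k \<le>
        2 * N * A * (3 + c) * h * d\<^sup>2 + h * (2 * N * A * (\<delta> + c * h + \<delta> * c * h))"
      by (simp add: \<mu>_def algebra_simps)
    have "2 * (2 * d + 2 * r)\<^sup>2 + 2 * C \<le> 16 * d\<^sup>2 + 16 * r\<^sup>2 + 2 * C"
      using sum_squares_bound[of d r] by (simp add: power2_eq_square algebra_simps)
    then have "\<mu>\<^sup>2 * (2 * (2 * d + 2 * r)\<^sup>2 + 2 * C) \<le> \<mu>\<^sup>2 * (16 * d\<^sup>2 + 16 * r\<^sup>2 + 2 * C)"
      by (intro mult_left_mono) auto
    also have "\<dots> = 16 * N\<^sup>2 * d\<^sup>2 * h\<^sup>2 + h * (N\<^sup>2 * h * (16 * r\<^sup>2 + 2 * C))"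
      by (simp add: \<mu>_def power2_eq_square algebra_simps)
    also have "\<dots> \<le> 16 * N\<^sup>2 * d\<^sup>2 * h + h * (N\<^sup>2 * h * (16 * r\<^sup>2 + 2 * C))"
      using hh by (intro add_right_mono mult_left_mono) auto
    finally have 3: "\<mu>\<^sup>2 * (2 * (2 * d + 2 * r)\<^sup>2 + 2 * C)
      \<le> 16 * N\<^sup>2 * d\<^sup>2 * h + h * (N\<^sup>2 * h * (16 * r\<^sup>2 + 2 * C))" .
    have "?bound = (d\<^sup>2 + c * h * d\<^sup>2 + c * h\<^sup>2 + c\<^sup>2 * h\<^sup>2) +
        (2 * N * A * (3 + c) * h * d\<^sup>2 + h * (2 * N * A * (\<delta> + c * h + \<delta> * c * h))) +
        (16 * N\<^sup>2 * d\<^sup>2 * h + h * (N\<^sup>2 * h * (16 * r\<^sup>2 + 2 * C)))"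
      unfolding d_def[symmetric] by (simp add: power2_eq_square algebra_simps)
    with 1 2 3 show ?thesis by linarith
  qed
  have N2: "(of_nat CARD('n))\<^sup>2 = ennreal (N\<^sup>2)"
    by (simp add: N_def ennreal_of_nat_eq_real_of_nat ennreal_power)
  have "(\<integral>\<^sup>+w. ennreal ((norm (w - z))\<^sup>2) \<partial>abm_step \<phi> \<mu> \<nu> x) =
     (\<Sum>(i, j)\<in>UNIV. (\<integral>\<^sup>+e. (let w = x $ j + e; p = \<phi> \<bar>w - x $ i\<bar> in
         ennreal p * ennreal ((norm (move \<mu> i w x - z))\<^sup>2) + ennreal (1 - p) * ennreal ((norm (x - z))\<^sup>2)) \<partial>\<nu>))
      / (of_nat CARD('n))\<^sup>2"
    by (rule nn_integral_abm_step[OF lipschitz_on_continuous_on[OF \<phi>(1)] \<phi>(2) \<nu>]) measurable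
  also have "\<dots> \<le> (\<Sum>(i, j)\<in>UNIV. ennreal (G \<delta> C i j)) / (of_nat CARD('n))\<^sup>2"
    using pair_le by (intro divide_right_mono_ennreal sum_mono) (auto simp: case_prod_beta)
  also have "\<dots> = ennreal ((\<Sum>(i, j)\<in>UNIV. G \<delta> C i j) / N\<^sup>2)"
    unfolding N2 using N GC0 by (simp add: case_prod_beta divide_ennreal sum_nonneg)
  also have "\<dots> \<le> ennreal ?bound"
    unfolding sumG using sq bound by (intro ennreal_leI) linarith
  finally show ?thesis by (simp add: \<mu>_def)
qed

section \<open>Convergence of the trajectories\<close>

lemma skorokhod_dist_le_of_uniform:
  assumes "f \<in> cadlag T" "g \<in> cadlag T" "0 < e" "\<And>t. t \<in> {0..T} \<Longrightarrow> dist (f t) (g t) \<le> e"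
  shows "skorokhod_dist T f g \<le> e"
proof -
  have "skorokhod_close T e f g"
    unfolding skorokhod_close_def using assms by (intro bexI[OF _ time_changes_id]) auto
  then show ?thesis
    using assms unfolding skorokhod_dist_def by (auto intro!: cInf_lower bdd_belowI[of _ 0])
qed

text \<open>The limit is a single path, so continuity of \<open>f\<close> at that path suffices: off
  the exceptional set \<open>f\<close> changes by less than e/2, on it by at most
  \<open>2 * b\<close>. Handing over a measurable exceptional set avoids any question about the
  measurability of a supremum over \<open>t\<close>.\<close>

lemma converges_in_distribution_of_uniform_in_probability:
  fixes X :: "real \<Rightarrow> 's::metric_space" and Z :: "'h \<Rightarrow> 'a \<Rightarrow> real \<Rightarrow> 's"
  assumes X: "X \<in> cadlag T"
    and Z: "\<forall>\<^sub>F h in F. prob_space (M h) \<and> Z h \<in> M h \<rightarrow>\<^sub>M sigma (cadlag T) {U. openin (skorokhod T) U}"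
    and close: "\<And>e. 0 < e \<Longrightarrow> \<exists>p. (p \<longlongrightarrow> 0) F \<and>
      (\<forall>\<^sub>F h in F. \<exists>S\<in>sets (M h). measure (M h) S \<le> p h \<and>
        (\<forall>\<omega>\<in>space (M h) - S. \<forall>t\<in>{0..T}. dist (X t) (Z h \<omega> t) \<le> e))"
  shows "converges_in_distribution (skorokhod T) M Z (return (count_space UNIV) ()) (\<lambda>_. X) F"
  unfolding converges_in_distribution_def
proof (intro allI impI, elim conjE)
  interpret D: Metric_space "cadlag T :: (real \<Rightarrow> 's) set" "skorokhod_dist T"
    by (rule Metric_space_skorokhod)
  interpret R: prob_space "return (count_space UNIV) ()" by (rule prob_space_return) simp
  fix f :: "(real \<Rightarrow> 's) \<Rightarrow> real"
  assume f: "continuous_map (skorokhod T) euclideanreal f" and "bounded (f ` topspace (skorokhod T))"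
  then obtain b where b: "\<And>g. g \<in> cadlag T \<Longrightarrow> \<bar>f g\<bar> \<le> b"
    by (auto simp: bounded_iff topspace_skorokhod)
  then have b0: "0 \<le> b" using X by (meson abs_ge_zero order.trans)
  let ?Sk = "sigma (cadlag T) {U. openin (skorokhod T) U} :: (real \<Rightarrow> 's) measure"
  have sub: "{U. openin (skorokhod T) U} \<subseteq> Pow (cadlag T :: (real \<Rightarrow> 's) set)"
    using openin_subset[of "skorokhod T"] by (auto simp: topspace_skorokhod)
  \<comment> \<open>Trajectories are measurable for the \<sigma>-algebra generated by the Skorokhod
    open sets. Composed with \<open>f\<close> this gives integrability, without which the integral
    could be 0 by convention.\<close>
  have fm: "f \<in> borel_measurable ?Sk"
  proof (rule borel_measurableI)
    fix S :: "real set" assume "open S"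
    then have "openin (skorokhod T) {g \<in> topspace (skorokhod T). f g \<in> S}"
      by (intro openin_continuous_map_preimage[OF f]) simp
    moreover have "{g \<in> topspace (skorokhod T). f g \<in> S} = f -` S \<inter> space ?Sk"
      using sub by (auto simp: topspace_skorokhod space_measure_of)
    ultimately show "f -` S \<inter> space ?Sk \<in> sets ?Sk"
      using sub by (simp add: sets_measure_of sigma_sets.Basic)
  qed
  have "((\<lambda>h. \<integral>\<omega>. f (Z h \<omega>) \<partial>M h) \<longlongrightarrow> f X) F"
  proof (rule tendstoI)
    fix e :: real assume e: "0 < e"
    have "openin (skorokhod T) {g \<in> topspace (skorokhod T). f g \<in> ball (f X) (e / 2)}"
      by (intro openin_continuous_map_preimage[OF f]) simp
    then have "openin D.mtopology {g \<in> cadlag T. f g \<in> ball (f X) (e / 2)}"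
      by (simp add: topspace_skorokhod flip: skorokhod_def)
    then obtain r where r: "0 < r" "D.mball X r \<subseteq> {g \<in> cadlag T. f g \<in> ball (f X) (e / 2)}"
      unfolding D.openin_mtopology using X e by force
    \<comment> \<open>Closeness up to \<open>r / 2\<close>, because the ball of radius
      \<open>r\<close> is open.\<close>
    obtain p where p: "(p \<longlongrightarrow> 0) F"
      "\<forall>\<^sub>F h in F. \<exists>S\<in>sets (M h). measure (M h) S \<le> p h \<and>
        (\<forall>\<omega>\<in>space (M h) - S. \<forall>t\<in>{0..T}. dist (X t) (Z h \<omega> t) \<le> r / 2)"
      using close[of "r / 2"] r(1) by auto
    have "((\<lambda>h. e / 2 + 2 * b * p h) \<longlongrightarrow> e / 2 + 2 * b * 0) F"
      by (intro tendsto_intros p(1))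
    then have "\<forall>\<^sub>F h in F. e / 2 + 2 * b * p h < e"
      by (rule order_tendstoD(2)) (use e in simp)
    with p(2) Z show "\<forall>\<^sub>F h in F. dist (\<integral>\<omega>. f (Z h \<omega>) \<partial>M h) (f X) < e"
    proof eventually_elim
      case (elim h)
      then interpret prob_space "M h" by simp
      from elim obtain S where S [measurable]: "S \<in> sets (M h)" and PS: "measure (M h) S \<le> p h"
        and off: "\<And>\<omega> t. \<omega> \<in> space (M h) - S \<Longrightarrow> t \<in> {0..T} \<Longrightarrow> dist (X t) (Z h \<omega> t) \<le> r / 2" by blast
      have Zm: "Z h \<in> M h \<rightarrow>\<^sub>M ?Sk" using elim by simp
      have Zc: "Z h \<omega> \<in> cadlag T" if "\<omega> \<in> space (M h)" for \<omega>
        using measurable_space[OF Zm that] sub by (simp add: space_measure_of)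
      have [measurable]: "(\<lambda>\<omega>. f (Z h \<omega>)) \<in> borel_measurable (M h)"
        by (rule measurable_compose[OF Zm fm])
      have int: "integrable (M h) (\<lambda>\<omega>. f (Z h \<omega>))"
        by (rule integrable_const_bound[where B = b]) (use Zc b in auto)
      have S_int: "integrable (M h) (indicator S :: _ \<Rightarrow> real)"
        by (intro integrable_real_indicator S) (simp add: less_top[symmetric])
      have "dist (\<integral>\<omega>. f (Z h \<omega>) \<partial>M h) (f X) = \<bar>\<integral>\<omega>. f (Z h \<omega>) - f X \<partial>M h\<bar>"
        using int by (simp add: dist_real_def prob_space)
      also have "\<dots> \<le> (\<integral>\<omega>. \<bar>f (Z h \<omega>) - f X\<bar> \<partial>M h)" by (rule integral_abs_bound)
      also have "\<dots> \<le> (\<integral>\<omega>. e / 2 + 2 * b * indicator S \<omega> \<partial>M h)"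
      proof (rule integral_mono)
        fix \<omega> assume \<omega>: "\<omega> \<in> space (M h)"
        show "\<bar>f (Z h \<omega>) - f X\<bar> \<le> e / 2 + 2 * b * indicator S \<omega>"
        proof (cases "\<omega> \<in> S")
          case True
          then show ?thesis using b[OF Zc[OF \<omega>]] b[OF X] e by simp
        next
          case False
          then have "skorokhod_dist T X (Z h \<omega>) \<le> r / 2"
            using off \<omega> r(1) by (intro skorokhod_dist_le_of_uniform X Zc) auto
          then have "Z h \<omega> \<in> D.mball X r" using r(1) X Zc[OF \<omega>] by simp
          from subsetD[OF r(2) this] False show ?thesis by (simp add: dist_real_def abs_minus_commute)
        qed
      qed (use int S_int in auto)
      also have "\<dots> = e / 2 + 2 * b * measure (M h) S" using S_int by (simp add: prob_space)
      also have "\<dots> \<le> e / 2 + 2 * b * p h" using PS b0 by (intro add_left_mono mult_left_mono) auto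
      finally show ?case using elim by simp
    qed
  qed
  then show "((\<lambda>h. \<integral>\<omega>. f (Z h \<omega>) \<partial>M h) \<longlongrightarrow> (\<integral>\<omega>. f X \<partial>return (count_space UNIV) ())) F"
    using R.prob_space by simp
qed

lemma continuous_on_imp_cadlag:
  assumes "X \<in> extensional {0..T}" and X: "continuous_on {0..T} X"
  shows "X \<in> cadlag T"
proof -
  have "(X \<longlongrightarrow> X t) (at_right t)" if t: "t \<in> {0..<T}" for t
  proof -
    have "(X \<longlongrightarrow> X t) (at t within {t..T})"
      using continuous_on_subset[OF X, of "{t..T}"] t by (auto simp: continuous_on_def)
    then show ?thesis using t by (simp add: at_within_Icc_at_right)
  qed
  moreover have "(X \<longlongrightarrow> X t) (at_left t)" if t: "t \<in> {0<..T}" for t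
  proof -
    have "(X \<longlongrightarrow> X t) (at t within {0..t})"
      using continuous_on_subset[OF X, of "{0..t}"] t by (auto simp: continuous_on_def)
    then show ?thesis using t by (simp add: at_within_Icc_at_left)
  qed
  ultimately show ?thesis using assms(1) unfolding cadlag_def by blast
qed

text \<open>\<open>K\<close> is the Lipschitz constant of the drift against points of the ball of
  radius \<open>norm x0\<close>. The drift vanishes at 0, so the speed is at most
  \<open>K * norm x0\<close>; hence along the path the drift changes at rate at most
  \<open>K * (K * norm x0)\<close>, which bounds the error of one Euler step.\<close>

lemma ode_solution_increments:
  fixes X :: "real \<Rightarrow> real ^ 'n"
  assumes \<phi>: "L-lipschitz_on {0..} \<phi>" "\<phi> \<in> {0..} \<rightarrow> {0..1}" and X: "ode_solution \<phi> T x0 X"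
  defines "K \<equiv> 2 * (1 + 2 * L * norm x0) * real CARD('n)"
  shows "\<And>s t. s \<in> {0..T} \<Longrightarrow> t \<in> {0..T} \<Longrightarrow> norm (X t - X s) \<le> K * norm x0 * \<bar>t - s\<bar>"
    and "\<And>t h. 0 \<le> t \<Longrightarrow> 0 \<le> h \<Longrightarrow> t + h \<le> T \<Longrightarrow>
      norm (X (t + h) - X t - h *\<^sub>R drift \<phi> (X t)) \<le> K * (K * norm x0) * h\<^sup>2"
proof -
  have \<phi>0: "\<phi> \<in> {0..} \<rightarrow> {0..}" using \<phi>(2) by auto
  have X': "(X has_vector_derivative drift \<phi> (X t)) (at t within {0..T})" if "t \<in> {0..T}" for t
    using X that by (auto simp: ode_solution_def)
  have le: "norm (X t) \<le> norm x0" if "t \<in> {0..T}" for t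
    using norm_ode_solution_le[OF \<phi>0 X' that] X by (simp add: ode_solution_def)
  have K0: "0 \<le> K" using lipschitz_on_nonneg[OF \<phi>(1)] by (simp add: K_def)
  have speed: "norm (drift \<phi> (X t)) \<le> K * norm x0" if "t \<in> {0..T}" for t
  proof -
    have "norm (drift \<phi> (X t) - drift \<phi> 0) \<le> K * norm (X t - 0)"
      unfolding K_def by (rule norm_drift_diff_le_of_lipschitz[OF \<phi>]) simp
    also have "\<dots> \<le> K * norm x0" using le[OF that] K0 by (simp add: mult_left_mono)
    finally show ?thesis by simp
  qed
  show incr: "norm (X t - X s) \<le> K * norm x0 * \<bar>t - s\<bar>" if "s \<in> {0..T}" "t \<in> {0..T}" for s t
  proof -
    have "norm (X t - X s) \<le> K * norm x0 * norm (t - s)"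
    proof (rule differentiable_bound[OF convex_real_interval(5)[of 0 T]])
      fix u assume u: "u \<in> {0..T}"
      show "(X has_derivative (\<lambda>a. a *\<^sub>R drift \<phi> (X u))) (at u within {0..T})"
        using X'[OF u] by (simp add: has_vector_derivative_def)
      show "onorm (\<lambda>a. a *\<^sub>R drift \<phi> (X u)) \<le> K * norm x0"
        using speed[OF u] by (intro onorm_le) (simp add: mult.commute mult_left_mono)
    qed (use that in auto)
    then show ?thesis by simp
  qed
  fix t h assume th: "0 \<le> t" "0 \<le> h" "t + h \<le> T"
  have "norm (X (t + h) - X t - (t + h - t) *\<^sub>R drift \<phi> (X t)) \<le> norm (t + h - t) * (K * (K * norm x0 * h))"
  proof (rule vector_differentiable_bound_linearization[of "{t..t + h}"])
    fix u assume u: "u \<in> {t..t + h}"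
    show "(X has_vector_derivative drift \<phi> (X u)) (at u within {t..t + h})"
      using X'[of u] th u by (auto intro: has_vector_derivative_within_subset)
    have "norm (drift \<phi> (X u) - drift \<phi> (X t)) \<le> K * norm (X u - X t)"
      unfolding K_def using th le[of t] by (intro norm_drift_diff_le_of_lipschitz[OF \<phi>]) auto
    also have "\<dots> \<le> K * (K * norm x0 * \<bar>u - t\<bar>)"
      using th u K0 by (intro mult_left_mono incr) auto
    also have "\<dots> \<le> K * (K * norm x0 * h)" using u K0 by (intro mult_left_mono) auto
    finally show "norm (drift \<phi> (X u) - drift \<phi> (X t)) \<le> K * (K * norm x0 * h)" .
  qed (use th in \<open>auto simp: closed_segment_eq_real_ivl\<close>)
  then show "norm (X (t + h) - X t - h *\<^sub>R drift \<phi> (X t)) \<le> K * (K * norm x0) * h\<^sup>2"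
    using th by (simp add: power2_eq_square ac_simps)
qed

text \<open>The maximal inequality is applied with q = 1 + B h and \<epsilon> = h E, where B is free
  of \<open>h\<close> and \<delta>, and E is small with them. For m = floor(T/h) steps, m h \<le> T
  and q^m \<le> exp(B T). The constant \<open>c\<close> adds the speed bound and the Euler constant
  of the solution, so it dominates both.\<close>

lemma abm_uniform_deviation:
  fixes X :: "real \<Rightarrow> real ^ 'n"
  assumes \<phi>: "L-lipschitz_on {0..} \<phi>" "\<phi> \<in> {0..} \<rightarrow> {0..1}" and X: "ode_solution \<phi> T x0 X"
    and T: "0 \<le> T" and h: "0 < h" "h \<le> 1" and a: "0 < a"
    and \<nu>: "prob_space \<nu>" "sets \<nu> = sets borel"
    and int: "integrable \<nu> (\<lambda>e. \<bar>e\<bar>)" "integrable \<nu> (\<lambda>e. e\<^sup>2)"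
    and \<delta>: "(\<integral>e. \<bar>e\<bar> \<partial>\<nu>) \<le> \<delta>" "\<delta> \<le> 1" and C: "(\<integral>e. e\<^sup>2 \<partial>\<nu>) \<le> C"
    and abm: "abm \<phi> (real CARD('n) * h) \<nu> x0 M x"
  defines "N \<equiv> real CARD('n)" and "A \<equiv> 1 + 2 * L * norm x0"
  defines "c \<equiv> 2 * A * N * norm x0 + 2 * A * N * (2 * A * N * norm x0)"
  shows "measure M {\<omega>\<in>space M. \<exists>k\<le>nat \<lfloor>T / h\<rfloor>. a \<le> (norm (x k \<omega> - X (real k * h)))\<^sup>2} \<le>
    exp ((c + 2 * N * A * (3 + c) + 16 * N\<^sup>2) * T) * T *
      (c * h + c\<^sup>2 * h + 2 * N * A * (\<delta> + c * h + \<delta> * c * h) + N\<^sup>2 * h * (16 * (norm x0)\<^sup>2 + 2 * C)) / a"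
    (is "_ \<le> exp (?B * T) * T * ?E / a")
proof -
  have \<phi>0: "\<phi> \<in> {0..} \<rightarrow> {0..}" and \<phi>c: "continuous_on {0..} \<phi>"
    using \<phi>(2) lipschitz_on_continuous_on[OF \<phi>(1)] by auto
  have A: "0 \<le> A" using lipschitz_on_nonneg[OF \<phi>(1)] by (simp add: A_def)
  have N: "0 < N" by (simp add: N_def)
  have K0: "0 \<le> 2 * A * N * norm x0" "0 \<le> 2 * A * N * (2 * A * N * norm x0)" using A N by simp_all
  then have c: "0 \<le> c" "2 * A * N * norm x0 \<le> c" "2 * A * N * (2 * A * N * norm x0) \<le> c"
    by (auto simp: c_def)
  have \<delta>0: "0 \<le> \<delta>" by (rule order.trans[OF Bochner_Integration.integral_nonneg \<delta>(1)]) simp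
  have C0: "0 \<le> C" by (rule order.trans[OF Bochner_Integration.integral_nonneg C]) simp
  have B0: "0 \<le> ?B" and E0: "0 \<le> ?E" using c A N \<delta>0 C0 h by simp_all
  let ?m = "nat \<lfloor>T / h\<rfloor>"
  have mh: "real ?m * h \<le> T"
  proof -
    have "real ?m \<le> T / h" using T h by simp
    then show ?thesis using h by (simp add: pos_le_divide_eq)
  qed
  have kh: "real k * h \<in> {0..T}" if "k \<le> ?m" for k
  proof -
    have "real k * h \<le> real ?m * h" using that h by (intro mult_right_mono) auto
    from order.trans[OF this mh] show ?thesis using h by simp
  qed
  have "measure M {\<omega>\<in>space M. \<exists>k\<le>?m. a \<le> (norm (x k \<omega> - X (real k * h)))\<^sup>2}
     \<le> (1 + ?B * h) ^ ?m * (real ?m * (h * ?E)) / a"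
  proof (rule markov_chain_maximal_inequality[where V = "\<lambda>k w. (norm (w - X (real k * h)))\<^sup>2"])
    show "markov_chain M (abm_step \<phi> (N * h) \<nu>) x0 x" using abm by (simp add: abm_def N_def)
    show "abm_step \<phi> (N * h) \<nu> \<in> borel \<rightarrow>\<^sub>M subprob_algebra borel"
      by (rule measurable_abm_step[OF \<phi>c \<phi>(2) \<nu>])
    show "(norm (x0 - X (real 0 * h)))\<^sup>2 = 0" using X by (simp add: ode_solution_def)
    show "1 \<le> 1 + ?B * h" "0 \<le> h * ?E" using B0 E0 h by simp_all
    fix n y assume n: "n < ?m"
    \<comment> \<open>Since \<open>n < ?m\<close>, the next grid time still lies in [0,T], where the
      differential equation is available.\<close>
    have t: "0 \<le> real n * h" "real n * h + h \<le> T" "real (Suc n) * h = real n * h + h"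
      using kh[of n] kh[of "Suc n"] n by (auto simp: algebra_simps)
    have Kdef: "2 * (1 + 2 * L * norm x0) * real CARD('n) = 2 * A * N" by (simp add: A_def N_def)
    note incr = ode_solution_increments[OF \<phi> X, unfolded Kdef]
    show "(\<integral>\<^sup>+w. ennreal ((norm (w - X (real (Suc n) * h)))\<^sup>2) \<partial>abm_step \<phi> (N * h) \<nu> y)
       \<le> ennreal ((1 + ?B * h) * (norm (y - X (real n * h)))\<^sup>2 + h * ?E)"
      unfolding N_def A_def
    proof (rule abm_step_mean_square_le[OF \<phi> \<nu> int \<delta> C _ h c(1)])
      show "norm (X (real n * h)) \<le> norm x0"
        using norm_ode_solution_le[OF \<phi>0, of T X "real n * h"] X kh[of n] n by (simp add: ode_solution_def)
      show "norm (X (real (Suc n) * h) - X (real n * h)) \<le> c * h"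
      proof -
        have "norm (X (real (Suc n) * h) - X (real n * h)) \<le> 2 * A * N * norm x0 * h"
          using incr(1)[of "real n * h" "real (Suc n) * h"] kh[of n] kh[of "Suc n"] n t(3) h by simp
        also have "\<dots> \<le> c * h" using c(2) h by (intro mult_right_mono) auto
        finally show ?thesis .
      qed
      show "norm (X (real (Suc n) * h) - X (real n * h) - h *\<^sub>R drift \<phi> (X (real n * h))) \<le> c * h\<^sup>2"
      proof -
        have "norm (X (real (Suc n) * h) - X (real n * h) - h *\<^sub>R drift \<phi> (X (real n * h)))
            \<le> 2 * A * N * (2 * A * N * norm x0) * h\<^sup>2"
          using incr(2)[of "real n * h" h] t h by simp
        also have "\<dots> \<le> c * h\<^sup>2" using c(3) by (intro mult_right_mono) auto
        finally show ?thesis .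
      qed
    qed
  qed (use a in auto)
  also have "\<dots> \<le> exp (?B * T) * (T * ?E) / a"
  proof (rule divide_right_mono[OF mult_mono])
    have "(1 + ?B * h) ^ ?m \<le> exp (?B * h) ^ ?m"
      using B0 h by (intro power_mono exp_ge_add_one_self) auto
    also have "\<dots> = exp (?B * (real ?m * h))" by (simp only: exp_of_nat_mult[symmetric] ac_simps)
    also have "\<dots> \<le> exp (?B * T)" using mh B0 by (simp add: mult_left_mono)
    finally show "(1 + ?B * h) ^ ?m \<le> exp (?B * T)" .
    show "real ?m * (h * ?E) \<le> T * ?E"
      using mult_right_mono[OF mh E0] by (simp only: mult.assoc)
  qed (use a h E0 in auto)
  finally show ?thesis by (simp only: mult.assoc)
qed

text \<open>The models for different \<open>h\<close> may live on unrelated probability spaces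
  \<open>M h\<close>, and the noise enters only through its law. The deterministic limit is encoded
  as a constant on a one-point space.\<close>

theorem mainTheorem5:
  fixes T :: real and x\<^sub>0 :: "real ^ 'n" and \<phi> :: "real \<Rightarrow> real" and C :: real
    and Q :: "real \<Rightarrow> 'e measure" and \<eta> :: "real \<Rightarrow> 'e \<Rightarrow> real"
    and M :: "real \<Rightarrow> 'a measure" and x :: "real \<Rightarrow> nat \<Rightarrow> 'a \<Rightarrow> real ^ 'n"
  assumes "0 \<le> T"
    and "\<exists>L. L-lipschitz_on {0..} \<phi>" and "\<phi> \<in> {0..} \<rightarrow> {0..1}"
    and "\<And>h. h > 0 \<Longrightarrow> prob_space (Q h)"
    and "\<And>h. h > 0 \<Longrightarrow> \<eta> h \<in> borel_measurable (Q h)"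
    and "((\<lambda>h. \<integral>\<omega>. \<bar>\<eta> h \<omega>\<bar> \<partial>Q h) \<longlongrightarrow> 0) (at_right 0)"
    and "0 < C"
    and "\<And>h. h > 0 \<Longrightarrow> integrable (Q h) (\<lambda>\<omega>. (\<eta> h \<omega>)\<^sup>2)"
    and "\<And>h. h > 0 \<Longrightarrow> (\<integral>\<omega>. (\<eta> h \<omega>)\<^sup>2 \<partial>Q h) < C"
    and "\<And>h. h > 0 \<Longrightarrow> abm \<phi> (real CARD('n) * h) (distr (Q h) borel (\<eta> h)) x\<^sub>0 (M h) (x h)"
  shows "\<exists>X. ode_solution \<phi> T x\<^sub>0 X \<and>
           (\<forall>Y. ode_solution \<phi> T x\<^sub>0 Y \<longrightarrow> Y = X) \<and>
           converges_in_distribution (skorokhod T)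
             M (\<lambda>h. trajectory T h (x h)) (return (count_space UNIV) ()) (\<lambda>_. X) (at_right 0)"
proof -
  obtain L where \<phi>: "L-lipschitz_on {0..} \<phi>" "\<phi> \<in> {0..} \<rightarrow> {0..1}" using assms(2,3) by blast
  obtain X where X: "ode_solution \<phi> T x\<^sub>0 X" using ode_solution_exists[OF \<phi> assms(1)] by blast
  define N where "N = real CARD('n)"
  define A where "A = 1 + 2 * L * norm x\<^sub>0"
  \<comment> \<open>The speed bound of \<open>X\<close>; with it \<open>c\<close> is the constant of
    the deviation bound.\<close>
  define s where "s = 2 * A * N * norm x\<^sub>0"
  define c where "c = s + 2 * A * N * s"
  define \<delta> where "\<delta> h = (\<integral>\<omega>. \<bar>\<eta> h \<omega>\<bar> \<partial>Q h)" for h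
  define E where "E h = c * h + c\<^sup>2 * h + 2 * N * A * (\<delta> h + c * h + \<delta> h * c * h)
    + N\<^sup>2 * h * (16 * (norm x\<^sub>0)\<^sup>2 + 2 * C)" for h
  have \<delta>0: "(\<delta> \<longlongrightarrow> 0) (at_right 0)" using assms(6) unfolding \<delta>_def .
  have h0: "((\<lambda>h::real. h) \<longlongrightarrow> 0) (at_right 0)" by (rule tendsto_ident_at)
  have E0: "(E \<longlongrightarrow> 0) (at_right 0)"
    unfolding E_def by (auto intro!: tendsto_eq_intros \<delta>0 h0)
  have chain: "prob_space (M h)" "\<And>n. x h n \<in> borel_measurable (M h)" if "0 < h" for h
    using assms(10)[OF that] by (auto simp: abm_def markov_chain_def)
  have "converges_in_distribution (skorokhod T)
      M (\<lambda>h. trajectory T h (x h)) (return (count_space UNIV) ()) (\<lambda>_. X) (at_right 0)"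
  proof (rule converges_in_distribution_of_uniform_in_probability)
    show "X \<in> cadlag T"
      using X by (auto simp: ode_solution_def intro!: continuous_on_imp_cadlag continuous_on_vector_derivative)
    show "\<forall>\<^sub>F h in at_right 0. prob_space (M h) \<and>
        trajectory T h (x h) \<in> M h \<rightarrow>\<^sub>M sigma (cadlag T) {U. openin (skorokhod T) U}"
      using eventually_at_right_less[of 0]
      by eventually_elim (auto intro: chain trajectory_measurable)
    fix e :: real assume e: "0 < e"
    \<comment> \<open>The budget \<open>e\<close> is halved: one half for the chain against
      \<open>X\<close> on the grid, squared because the deviation bound concerns squares, the other
      for the motion of \<open>X\<close> within one step, at most \<open>s * h\<close>.\<close>
    define p where "p h = exp ((c + 2 * N * A * (3 + c) + 16 * N\<^sup>2) * T) * T * E h / (e / 2)\<^sup>2" for h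
    have p: "(p \<longlongrightarrow> 0) (at_right 0)"
      unfolding p_def using e by (auto intro!: tendsto_eq_intros E0)
    have "((\<lambda>h. s * h) \<longlongrightarrow> 0) (at_right 0)" by (auto intro!: tendsto_eq_intros)
    then have "\<forall>\<^sub>F h in at_right 0. s * h < e / 2" by (rule order_tendstoD(2)) (use e in simp)
    \<comment> \<open>This and \<open>h < 1\<close> provide the smallness conditions of the one-step
      estimate.\<close>
    moreover have "\<forall>\<^sub>F h in at_right 0. \<delta> h < 1" using \<delta>0 by (rule order_tendstoD(2)) simp
    moreover have "\<forall>\<^sub>F h in at_right (0::real). h < 1" using h0 by (rule order_tendstoD(2)) simp
    moreover note eventually_at_right_less[of 0]
    ultimately have "\<forall>\<^sub>F h in at_right 0. \<exists>S\<in>sets (M h). measure (M h) S \<le> p h \<and>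
        (\<forall>\<omega>\<in>space (M h) - S. \<forall>t\<in>{0..T}. dist (X t) (trajectory T h (x h) \<omega> t) \<le> e)"
    proof eventually_elim
      case (elim h)
      note h = \<open>0 < h\<close>
      interpret Q: prob_space "Q h" by (rule assms(4)[OF h])
      interpret prob_space "M h" by (rule chain(1)[OF h])
      note [measurable] = assms(5)[OF h] chain(2)[OF h]
      have \<eta>: "integrable (Q h) (\<eta> h)"
        by (rule Q.square_integrable_imp_integrable[OF assms(5)[OF h] assms(8)[OF h]])
      define S where "S = {\<omega>\<in>space (M h). \<exists>k\<le>nat \<lfloor>T / h\<rfloor>. (e / 2)\<^sup>2 \<le> (norm (x h k \<omega> - X (real k * h)))\<^sup>2}"
      have "measure (M h) S \<le> p h"
        unfolding S_def p_def E_def c_def s_def N_def A_def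
      proof (rule abm_uniform_deviation[OF \<phi> X assms(1) h])
        show "abm \<phi> (real CARD('n) * h) (distr (Q h) borel (\<eta> h)) x\<^sub>0 (M h) (x h)" by (rule assms(10)[OF h])
        show "prob_space (distr (Q h) borel (\<eta> h))" by (rule Q.prob_space_distr) measurable
        show "integrable (distr (Q h) borel (\<eta> h)) (\<lambda>e. \<bar>e\<bar>)" "integrable (distr (Q h) borel (\<eta> h)) (\<lambda>e. e\<^sup>2)"
          using \<eta> assms(8)[OF h] by (simp_all add: integrable_distr_eq)
        show "(\<integral>e. \<bar>e\<bar> \<partial>distr (Q h) borel (\<eta> h)) \<le> \<delta> h" by (simp add: integral_distr \<delta>_def)
        show "(\<integral>e. e\<^sup>2 \<partial>distr (Q h) borel (\<eta> h)) \<le> C" using assms(9)[OF h] by (simp add: integral_distr)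
      qed (use elim e in auto)
      moreover have "dist (X t) (trajectory T h (x h) \<omega> t) \<le> e"
        if \<omega>: "\<omega> \<in> space (M h) - S" and t: "t \<in> {0..T}" for \<omega> t
      proof -
        \<comment> \<open>The last grid time not after \<open>t\<close>: the trajectory at
          \<open>t\<close> is the chain after \<open>k\<close> steps, so the error is split at
          \<open>real k * h\<close>.\<close>
        define k where "k = nat \<lfloor>t / h\<rfloor>"
        have "k \<le> nat \<lfloor>T / h\<rfloor>"
          unfolding k_def using t h by (intro nat_mono floor_mono divide_right_mono) auto
        then have "(norm (x h k \<omega> - X (real k * h)))\<^sup>2 < (e / 2)\<^sup>2"
          using \<omega> unfolding S_def not_le[symmetric] by blast
        then have 1: "dist (X (real k * h)) (x h k \<omega>) < e / 2"
          using e power_less_imp_less_base[of "norm (x h k \<omega> - X (real k * h))" 2 "e / 2"]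
          by (simp add: dist_norm norm_minus_commute)
        have "real k \<le> t / h" "t / h \<le> real k + 1" using t h by (auto simp: k_def)
        then have kt: "real k * h \<le> t" "t \<le> real k * h + h" using h by (auto simp: field_simps)
        have "s = 2 * (1 + 2 * L * norm x\<^sub>0) * real CARD('n) * norm x\<^sub>0" by (simp add: s_def A_def N_def)
        then have "dist (X t) (X (real k * h)) \<le> s * \<bar>t - real k * h\<bar>"
          using ode_solution_increments(1)[OF \<phi> X, of "real k * h" t] t kt h by (simp add: dist_norm)
        also have "\<dots> \<le> s * h"
        proof (rule mult_left_mono)
          show "0 \<le> s" using lipschitz_on_nonneg[OF \<phi>(1)] by (simp add: s_def A_def N_def)
        qed (use kt in simp)
        finally have "dist (X t) (x h k \<omega>) \<le> e"
          using 1 \<open>s * h < e / 2\<close> dist_triangle[of "X t" "x h k \<omega>" "X (real k * h)"] by linarith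
        then show ?thesis using t by (simp add: trajectory_def k_def)
      qed
      moreover have "S \<in> sets (M h)" unfolding S_def by measurable
      ultimately show ?case by blast
    qed
    with p show "\<exists>p. (p \<longlongrightarrow> 0) (at_right 0) \<and> (\<forall>\<^sub>F h in at_right 0. \<exists>S\<in>sets (M h). measure (M h) S \<le> p h \<and>
        (\<forall>\<omega>\<in>space (M h) - S. \<forall>t\<in>{0..T}. dist (X t) (trajectory T h (x h) \<omega> t) \<le> e))" by blast
  qed
  then show ?thesis using X ode_solution_unique[OF \<phi> _ X] by blast
qed

end
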